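(* Let $\tilde u$ satisfy Condition $Z$-SINH1$(a_-,a_+;\alpha)$ (stated in the context) with exponent $m_{\tilde u}$, and let $n> m_{\tilde u}$. Then: (a) for any $\omega_\ell\in(\pi/2-\alpha,\pi/2)$ there exist $\sigma_\ell>0$ and $b_\ell>0$ such that $b_\ell>\sigma_\ell\sin(\omega_\ell)$ and $\sigma_\ell-b_\ell\sin(\omega_\ell)\in(a_-,a_+)$; (b) if a triplet $(\sigma_\ell,b_\ell,\omega_\ell)$ satisfies the conditions in (a) (that is, $\omega_\ell\in(\pi/2-\alpha,\pi/2)$, $\sigma_\ell>0$, $b_\ell>0$, $b_\ell>\sigma_\ell\sin(\omega_\ell)$ and $\sigma_\ell-b_\ell\sin(\omega_\ell)\in(a_-,a_+)$), then the distance from the curve $\mathcal L_{L;\sigma_\ell,b_\ell,\omega_\ell}$ to the origin equals $\sigma_\ell-b_\ell\sin(\omega_\ell)$, one has $\mathcal L_{L;\sigma_\ell,b_\ell,\omega_\ell}\subset\mathcal U(a_-,a_+,\alpha)$, and $$u_n=\frac{1}{2\pi i}\int_{\mathcal L_{L;\sigma_\ell,b_\ell,\omega_\ell}}\tilde u(z)z^{-n-1}\,dz;\qquad ( * )$$ (c) if $\alpha\in(\pi/2,\pi)$, then for any $\omega_\ell\in(\pi/2-\alpha,0]$, $b_\ell>0$ and $\sigma_\ell\in(a_-+b_\ell\sin(\omega_\ell),\,a_++b_\ell\sin(\omega_\ell))$, one has $\mathcal L_{L;\sigma_\ell,b_\ell,\omega_\ell}\subset\mathcal U(a_-,a_+,\alpha)$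 and $( * )$ is valid; (d) in both cases (b) and (c), there exists $d_\ell>0$ such that the image of the strip $S_{(-d_\ell,d_\ell)}$ under $\chi_{L;\sigma_\ell,b_\ell,\omega_\ell}$ is a subset of $\mathcal U(a_-,a_+,\alpha)$, and the distance from $\chi_{L;\sigma_\ell,b_\ell,\omega_\ell}(S_{(-d_\ell,d_\ell)})$ to the origin equals $\sigma_\ell-b_\ell\sin(\omega_\ell+d_\ell)$.
   Context: Setting: $u=(u_k)_{k\in\mathbb Z}\in\ell_1(\mathbb Z)$, $\tilde u(z)=\sum_{k\in\mathbb Z}u_kz^k$ is its (two-sided) $Z$-transform, a continuous function on the unit circle $\mathbb T$ (one-sided sequences are the case $u_k=0$ for $k<0$), so that $u_n=\frac1{2\pi i}\int_{\mathbb T}\tilde u(z)z^{-n-1}dz$. The integer $n$ is nonnegative. The analytic continuation of $\tilde u$ is denoted by the same symbol. Sinh-deformation: for $\sigma_\ell\in\mathbb R$, $b_\ell>0$, $\omega_\ell\in(-\pi/2,\pi/2)$, set $\chi_{L;\sigma_\ell,b_\ell,\omega_\ell}(y)=\sigma_\ell+ib_\ell\sinh(i\omega_\ell+y)$ and $\mathcal L_{L;\sigma_\ell,b_\ell,\omega_\ell}=\chi_{L;\sigma_\ell,b_\ell,\omega_\ell}(\mathbb R)$, oriented by increasing $y\in\mathbb R$. For $d>0$, $S_{(-d,d)}=\{y\in\mathbb C : |\mathrm{Im}\,y|<d\}$. Domains: $\mathcal D(a_-,a_+)=\{z\in\mathbb C: a_-<|z|<a_+\}$; for $\alpha\in(0,\pi)$,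 $\mathcal C_\alpha=\{\rho e^{i\varphi}: |\varphi|<\alpha,\ \rho>0\}$; and $$\mathcal U(a_-,a_+,\alpha)=\mathcal D(a_-,a_+)\cup\big((a_+-\mathcal C_\alpha)\setminus\{z: |z|\le a_-\}\big).$$ Condition $Z$-SINH1$(a_-,a_+;\alpha)$: $0\le a_-<1\le a_+$ and $\alpha\in(0,\pi)$ are such that (i) $\tilde u$ admits analytic continuation to $\mathcal U(a_-,a_+,\alpha)$; (ii) for any $a_-<r_-<r_+<a_+$ and $\alpha_1\in(0,\alpha)$, $$|\tilde u(z)|\le C_{\tilde u}(r_-,r_+;\alpha_1)(1+|z|)^{m_{\tilde u}},\quad z\in\mathcal U(r_-,r_+,\alpha_1),$$ where $m_{\tilde u}$ depends only on $\tilde u$, and the constant $C_{\tilde u}(r_-,r_+;\alpha_1)$ depends on $(r_-,r_+,\alpha_1)$.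
   Formalization: For α<π/2 the curve can leave U(a_-,a_+,α) (e.g. a_-=0, a_+=1, α=π/4, ω=π/3, b=100, σ=1/2+100 sin ω), so for α<π/2 its inclusion in U in (b) is assumed, not concluded, and ( * ) and the strip inclusion in (d) are claimed only under it. *)

theory Defs
  imports "HOL-Analysis.Analysis"
begin

definition Z_transform :: "(int \<Rightarrow> complex) \<Rightarrow> complex \<Rightarrow> complex" where
  "Z_transform u z = (\<Sum>\<^sub>\<infinity>k. u k * z powi k)"

definition chi :: "real \<Rightarrow> real \<Rightarrow> real \<Rightarrow> complex \<Rightarrow> complex" where
  "chi \<sigma> b \<omega> y = of_real \<sigma> + \<i> * of_real b * sinh (\<i> * of_real \<omega> + y)"

definition sinh_path :: "real \<Rightarrow> real \<Rightarrow> real \<Rightarrow> real \<Rightarrow> complex" where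
  "sinh_path \<sigma> b \<omega> y = chi \<sigma> b \<omega> (of_real y)"

definition sinh_curve :: "real \<Rightarrow> real \<Rightarrow> real \<Rightarrow> complex set" where
  "sinh_curve \<sigma> b \<omega> = range (sinh_path \<sigma> b \<omega>)"

definition strip :: "real \<Rightarrow> complex set" where
  "strip d = {y. \<bar>Im y\<bar> < d}"

definition annulus :: "real \<Rightarrow> real \<Rightarrow> complex set" where
  "annulus am ap = {z. am < norm z \<and> norm z < ap}"

definition cone :: "real \<Rightarrow> complex set" where
  "cone \<alpha> = {rcis \<rho> \<phi> | \<rho> \<phi>. \<bar>\<phi>\<bar> < \<alpha> \<and> 0 < \<rho>}"

definition U_dom :: "real \<Rightarrow> real \<Rightarrow> real \<Rightarrow> complex set" where
  "U_dom am ap \<alpha> =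
     annulus am ap \<union> ((\<lambda>w. of_real ap - w) ` cone \<alpha> - {z. norm z \<le> am})"

(* The Z-transform of an absolutely summable sequence is a priori a function on the unit
   circle T only.  If ap > 1, then T lies in U_dom am ap \<alpha> and the continuity clause below
   is implied by the other two.  If ap = 1, part of T lies on the boundary of the domain, and
   the continuation takes the values of the Z-transform there continuously from the annulus
   am < |z| < 1.  Continuity from outside the unit disc is not demanded: it may fail at z = 1
   for a one-sided sequence whose power series is continued beyond the disc. *)
definition continues_Z_transform ::
    "(complex \<Rightarrow> complex) \<Rightarrow> (int \<Rightarrow> complex) \<Rightarrow> real \<Rightarrow> real \<Rightarrow> real \<Rightarrow> bool" where
  "continues_Z_transform f u am ap \<alpha> \<longleftrightarrow>
     f holomorphic_on U_dom am ap \<alpha> \<and>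
     continuous_on {z. am < norm z \<and> norm z \<le> 1} f \<and>
     (\<forall>z. norm z = 1 \<longrightarrow> f z = Z_transform u z)"

definition Z_SINH1 ::
    "(int \<Rightarrow> complex) \<Rightarrow> (complex \<Rightarrow> complex) \<Rightarrow> real \<Rightarrow> real \<Rightarrow> real \<Rightarrow> real \<Rightarrow> bool" where
  "Z_SINH1 u f m am ap \<alpha> \<longleftrightarrow>
     0 \<le> am \<and> am < 1 \<and> 1 \<le> ap \<and> 0 < \<alpha> \<and> \<alpha> < pi \<and>
     continues_Z_transform f u am ap \<alpha> \<and>
     (\<forall>rm rp \<alpha>1. am < rm \<and> rm < rp \<and> rp < ap \<and> 0 < \<alpha>1 \<and> \<alpha>1 < \<alpha> \<longrightarrow>
        (\<exists>C. \<forall>z \<in> U_dom rm rp \<alpha>1. norm (f z) \<le> C * (1 + norm z) powr m))"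

(* The library's contour integrals are over compact paths; these curves are unbounded. *)
definition line_integrand ::
    "(real \<Rightarrow> complex) \<Rightarrow> (complex \<Rightarrow> complex) \<Rightarrow> real \<Rightarrow> complex" where
  "line_integrand \<gamma> g y = g (\<gamma> y) * vector_derivative \<gamma> (at y)"

definition coefficient_formula ::
    "(int \<Rightarrow> complex) \<Rightarrow> (complex \<Rightarrow> complex) \<Rightarrow> nat \<Rightarrow> real \<Rightarrow> real \<Rightarrow> real \<Rightarrow> bool" where
  "coefficient_formula u f n \<sigma> b \<omega> \<longleftrightarrow>
     (let g = line_integrand (sinh_path \<sigma> b \<omega>) (\<lambda>z. f z * z powi (- int n - 1))
      in integrable lborel g \<and>
         u (int n) = 1 / (2 * of_real pi * \<i>) * (LINT y|lborel. g y))"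

definition admissible ::
    "real \<Rightarrow> real \<Rightarrow> real \<Rightarrow> real \<Rightarrow> real \<Rightarrow> real \<Rightarrow> bool" where
  "admissible am ap \<alpha> \<sigma> b \<omega> \<longleftrightarrow>
     \<omega> \<in> {pi/2 - \<alpha> <..< pi/2} \<and> 0 < \<sigma> \<and> 0 < b \<and> \<sigma> * sin \<omega> < b \<and>
     \<sigma> - b * sin \<omega> \<in> {am <..< ap}"

(* For \<alpha> < pi/2 admissibility does not imply that the curve lies in U_dom am ap \<alpha>: for
   large b the curve is nearly vertical close to its vertex, leaves the annulus there and misses
   the cone; see not_subset_U_dom_if_acute below.  Inclusion is therefore a premise
   for acute \<alpha>, and only for acute \<alpha>. *)
definition inside_if_acute ::
    "real \<Rightarrow> real \<Rightarrow> real \<Rightarrow> real \<Rightarrow> real \<Rightarrow> real \<Rightarrow> bool" where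
  "inside_if_acute am ap \<alpha> \<sigma> b \<omega> \<longleftrightarrow>
     (\<alpha> < pi/2 \<longrightarrow> sinh_curve \<sigma> b \<omega> \<subseteq> U_dom am ap \<alpha>)"

lemma sinh_path_Re_Im:
  "Re (sinh_path \<sigma> b \<omega> y) = \<sigma> - b * sin \<omega> * cosh y"
  "Im (sinh_path \<sigma> b \<omega> y) = b * cos \<omega> * sinh y"
proof -
  have e: "sinh (\<i> * of_real \<omega> + of_real y) =
      \<i> * of_real (sin \<omega> * cosh y) + (of_real (cos \<omega> * sinh y) :: complex)"
  proof -
    have "sinh (of_real y :: complex) = of_real (sinh y)"
         "cosh (of_real y :: complex) = of_real (cosh y)"
      by (simp_all add: sinh_field_def cosh_field_def flip: exp_of_real)
    moreover have "sinh (\<i> * of_real \<omega>) = \<i> * of_real (sin \<omega>)"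
         "cosh (\<i> * of_real \<omega>) = of_real (cos \<omega>)"
      by (simp_all add: sinh_conv_sin cosh_conv_cos flip: sin_of_real cos_of_real mult.assoc)
    ultimately show ?thesis by (simp add: sinh_add)
  qed
  show "Re (sinh_path \<sigma> b \<omega> y) = \<sigma> - b * sin \<omega> * cosh y"
    "Im (sinh_path \<sigma> b \<omega> y) = b * cos \<omega> * sinh y"
    unfolding sinh_path_def chi_def e by simp_all
qed

lemma U_dom_acute_bound:
  assumes "0 < \<alpha>" "\<alpha> < pi/2" "0 \<le> ap" "z \<in> U_dom am ap \<alpha>" "Re z \<le> ap"
  shows "\<bar>Im z\<bar> \<le> ap + tan \<alpha> * (ap - Re z)"
proof -
  have t: "0 \<le> tan \<alpha>" using assms tan_gt_zero[of \<alpha>] by simp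
  from assms(4) consider "norm z < ap" | "z \<in> (\<lambda>w. of_real ap - w) ` cone \<alpha>"
    by (auto simp: U_dom_def annulus_def)
  then show ?thesis
  proof cases
    case 1
    have "0 \<le> tan \<alpha> * (ap - Re z)" using t assms(5) by simp
    then show ?thesis using 1 abs_Im_le_cmod[of z] by linarith
  next
    case 2
    then obtain \<rho> \<phi> where p: "\<bar>\<phi>\<bar> < \<alpha>" "0 < \<rho>" "z = of_real ap - rcis \<rho> \<phi>"
      by (auto simp: cone_def)
    have c: "0 < cos \<phi>" using p(1) assms(2) by (intro cos_gt_zero_pi) auto
    have im: "\<bar>Im z\<bar> = \<rho> * \<bar>sin \<phi>\<bar>" using p by (simp add: abs_mult)
    have re: "ap - Re z = \<rho> * cos \<phi>" using p by simp
    have "\<bar>tan \<phi>\<bar> \<le> tan \<alpha>"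
    proof -
      have "tan \<phi> < tan \<alpha>" using p(1) assms by (intro tan_monotone) auto
      moreover have "tan (-\<phi>) < tan \<alpha>" using p(1) assms by (intro tan_monotone) auto
      ultimately show ?thesis by simp
    qed
    then have "\<rho> * cos \<phi> * \<bar>tan \<phi>\<bar> \<le> \<rho> * cos \<phi> * tan \<alpha>"
      using p(2) c by (intro mult_left_mono) auto
    moreover have "\<rho> * cos \<phi> * \<bar>tan \<phi>\<bar> = \<rho> * \<bar>sin \<phi>\<bar>"
      using c by (simp add: tan_def)
    ultimately have "\<bar>Im z\<bar> \<le> tan \<alpha> * (ap - Re z)" using im re by (metis mult.commute)
    then show ?thesis using assms(3) by simp
  qed
qed

lemma not_subset_U_dom_if_acute:
  assumes "0 \<le> am" "am < 1" "1 \<le> ap" "0 < \<alpha>" "\<alpha> < pi/2"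
    and "\<omega> \<in> {pi/2 - \<alpha> <..< pi/2}"
  shows "\<exists>\<sigma> b. admissible am ap \<alpha> \<sigma> b \<omega> \<and> \<not> sinh_curve \<sigma> b \<omega> \<subseteq> U_dom am ap \<alpha>"
proof -
  define x0 s c where "x0 = (am + ap) / 2" and "s = sin \<omega>" and "c = cos \<omega>"
  have w: "0 < \<omega>" "\<omega> < pi/2" using assms by auto
  have s: "0 < s" "s \<le> 1" using w by (auto simp: s_def sin_gt_zero)
  have c: "0 < c" using w by (auto simp: c_def intro: cos_gt_zero)
  have sc: "s\<^sup>2 + c\<^sup>2 = 1" by (simp add: s_def c_def)
  have x0: "am < x0" "x0 < ap" "0 < x0" using assms by (auto simp: x0_def)
  define K where "K = ap + tan \<alpha> * (ap - (x0 - s))"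
  have "0 < tan \<alpha>" using assms by (intro tan_gt_zero) auto
  then have "0 \<le> tan \<alpha> * (ap - (x0 - s))" using x0 s by (intro mult_nonneg_nonneg) auto
  then have K: "0 < K" using assms unfolding K_def by linarith
  define b \<sigma> where "b = (K\<^sup>2 / 2 + x0) / c\<^sup>2" and "\<sigma> = x0 + b * s"
  have b: "0 < b" using K x0 c by (simp add: b_def add_nonneg_pos)
  have bc: "b * c\<^sup>2 = K\<^sup>2 / 2 + x0" using c by (simp add: b_def)
  have "x0 * s \<le> x0" using x0 s by (simp add: mult_left_le)
  then have "x0 * s < b * c\<^sup>2" using K unfolding bc by (simp add: add_strict_increasing)
  moreover have "\<sigma> * s = x0 * s + b * s\<^sup>2" by (simp add: \<sigma>_def power2_eq_square algebra_simps)
  moreover have "b * s\<^sup>2 + b * c\<^sup>2 = b" using sc by (metis distrib_left mult.right_neutral)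
  ultimately have "\<sigma> * s < b" by linarith
  then have adm: "admissible am ap \<alpha> \<sigma> b \<omega>"
    using assms x0 b s by (auto simp: admissible_def \<sigma>_def s_def add_pos_pos)
  define y where "y = arcosh (1 + 1 / b)"
  define z where "z = sinh_path \<sigma> b \<omega> y"
  have ch: "cosh y = 1 + 1 / b" using b by (simp add: y_def)
  have re: "Re z = x0 - s"
    using b by (simp add: z_def sinh_path_Re_Im ch \<sigma>_def flip: s_def) (simp add: field_simps)
  have "(Im z)\<^sup>2 = c\<^sup>2 * (b\<^sup>2 * ((cosh y)\<^sup>2 - 1))"
    by (simp add: z_def sinh_path_Re_Im cosh_square_eq power_mult_distrib flip: c_def)
  also have "b\<^sup>2 * ((cosh y)\<^sup>2 - 1) = 2 * b + 1"
    using b by (simp add: ch power2_eq_square field_simps)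
  also have "c\<^sup>2 * (2 * b + 1) = K\<^sup>2 + 2 * x0 + c\<^sup>2" using bc by (simp add: algebra_simps)
  finally have "K\<^sup>2 < \<bar>Im z\<bar>\<^sup>2" using x0 c by (simp add: add_pos_pos)
  then have "K < \<bar>Im z\<bar>" by (rule power2_less_imp_less) simp
  then have "z \<notin> U_dom am ap \<alpha>"
    using U_dom_acute_bound[of \<alpha> ap z am] assms x0 s re by (auto simp: K_def)
  moreover have "z \<in> sinh_curve \<sigma> b \<omega>" by (simp add: z_def sinh_curve_def)
  ultimately show ?thesis using adm by blast
qed

end

theory Submission
  imports Defs "HOL-Complex_Analysis.Complex_Analysis"
begin

text \<open>
Write \<open>z = - exp \<zeta>\<close>, so that the imaginary part of \<open>\<zeta>\<close> is the angle between \<open>z\<close> and the negative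
real axis. On each circle \<open>\<bar>z\<bar> = R\<close> with \<open>R > a\<^sub>-\<close>, the domain \<open>\<U>(a\<^sub>-, a\<^sub>+, \<alpha>)\<close> is an arc centred at the
negative axis (or the whole circle), and this arc shrinks as \<open>R\<close> grows
(\<open>U_dom_log_coords_mono\<close>). Hence the points \<open>\<zeta>\<close> over the domain, with \<open>\<bar>Im \<zeta>\<bar> < \<pi>\<close> required
beyond the annulus and no restriction over it, form a starlike set \<open>log_dom\<close>
(\<open>starlike_log_dom\<close>), and \<open>f(z) z\<^sup>-\<^sup>n\<^sup>-\<^sup>1 dz\<close>, with \<open>f\<close> the continued transform, has a primitive \<open>\<Phi>\<close>
there.

The coefficient formula follows by evaluating \<open>\<Phi>\<close>. The part of the curve over \<open>[0, Y]\<close> lifts to a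
path that starts on the line \<open>Im \<zeta> = - \<pi>\<close>, and the part over \<open>[-Y, 0]\<close> to one that ends on
\<open>Im \<zeta> = \<pi>\<close>. So the integral over \<open>[-Y, Y]\<close> is the increment of \<open>\<Phi>\<close> across a full period minus the
increment along the arc of the circle through \<open>z(Y)\<close> and \<open>z(-Y)\<close> that crosses the negative axis.
The period is the same for all circles in the annulus, and approaching the unit circle from
inside identifies it as \<open>2\<pi>i u\<^sub>n\<close> (\<open>primitive_period\<close>). The arc lies in the domain because the end
points do, so that the growth bound applies on it; it contributes \<open>O(\<bar>z(Y)\<bar>\<^bsup>m-n\<^esup>)\<close>, which tends to \<open>0\<close>
since \<open>n > m\<close>. The same bound makes the integrand decay exponentially in \<open>\<bar>y\<bar>\<close>.

The geometric claims rest on one identity: on the curve, \<open>\<bar>z\<bar>\<^sup>2\<close> is a quadratic polynomial in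
\<open>cosh y\<close> that increases with \<open>cosh y\<close> when \<open>\<sigma> sin \<omega> \<le> b\<close>, so that the vertex \<open>\<sigma> - b sin \<omega>\<close> is the
nearest point to the origin (\<open>norm_sinh_path_ge\<close>). A horizontal strip is mapped to the union of the curves with angles
near \<open>\<omega>\<close>. All conditions on \<open>\<omega>\<close> are open, which together with a uniform estimate of the tails
and compactness of the rest gives the strip claims.
\<close>

section \<open>The domain in logarithmic coordinates\<close>

text \<open>With \<open>w = \<rho> exp(i\<phi>)\<close> the difference of the two sides is \<open>\<rho> sin(\<alpha> - \<bar>\<phi>\<bar>)\<close>, whose sign
decides \<open>\<bar>\<phi>\<bar> < \<alpha>\<close> because \<open>\<alpha> - \<bar>\<phi>\<bar>\<close> lies strictly between \<open>-\<pi>\<close> and \<open>\<pi>\<close>. This turns the cone into a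
linear condition, uniformly for acute and obtuse \<open>\<alpha>\<close>.\<close>
lemma mem_cone_iff:
  assumes "0 < \<alpha>" "\<alpha> < pi"
  shows "w \<in> cone \<alpha> \<longleftrightarrow> cos \<alpha> * \<bar>Im w\<bar> < sin \<alpha> * Re w"
proof -
  have eq: "sin \<alpha> * Re (rcis \<rho> \<phi>) - cos \<alpha> * \<bar>Im (rcis \<rho> \<phi>)\<bar> = \<rho> * sin (\<alpha> - \<bar>\<phi>\<bar>)"
    if "\<bar>\<phi>\<bar> \<le> pi" "0 \<le> \<rho>" for \<rho> \<phi>
  proof -
    have "\<bar>sin \<phi>\<bar> = sin \<bar>\<phi>\<bar>"
      using that sin_ge_zero[of "\<bar>\<phi>\<bar>"] by (cases "0 \<le> \<phi>") auto
    then show ?thesis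
      using that by (simp add: sin_diff abs_mult algebra_simps)
  qed
  show ?thesis
  proof
    assume "w \<in> cone \<alpha>"
    then obtain \<rho> \<phi> where w: "w = rcis \<rho> \<phi>" "\<bar>\<phi>\<bar> < \<alpha>" "0 < \<rho>"
      by (auto simp: cone_def)
    then have "0 < \<rho> * sin (\<alpha> - \<bar>\<phi>\<bar>)"
      using assms by (intro mult_pos_pos sin_gt_zero) auto
    then show "cos \<alpha> * \<bar>Im w\<bar> < sin \<alpha> * Re w"
      using eq[of \<phi> \<rho>] w assms by simp
  next
    assume less: "cos \<alpha> * \<bar>Im w\<bar> < sin \<alpha> * Re w"
    then have "w \<noteq> 0" by auto
    define \<phi> where "\<phi> = Arg w"
    have w: "w = rcis (norm w) \<phi>" "\<bar>\<phi>\<bar> \<le> pi"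
      using Arg_bounded[of w] by (auto simp: \<phi>_def rcis_cmod_Arg)
    have "0 < norm w * sin (\<alpha> - \<bar>\<phi>\<bar>)"
      using eq[of \<phi> "norm w"] w less by simp
    then have pos: "0 < sin (\<alpha> - \<bar>\<phi>\<bar>)"
      using \<open>w \<noteq> 0\<close> by (simp add: zero_less_mult_iff)
    have "\<bar>\<phi>\<bar> < \<alpha>"
    proof (rule ccontr)
      assume "\<not> \<bar>\<phi>\<bar> < \<alpha>"
      then have "0 \<le> sin (\<bar>\<phi>\<bar> - \<alpha>)"
        using w(2) assms by (intro sin_ge_zero) auto
      then show False using pos sin_minus[of "\<bar>\<phi>\<bar> - \<alpha>"] by simp
    qed
    then show "w \<in> cone \<alpha>"
      using w(1) \<open>w \<noteq> 0\<close> unfolding cone_def mem_Collect_eq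
      by (metis zero_less_norm_iff)
  qed
qed

lemma mem_U_dom_iff:
  assumes "0 < \<alpha>" "\<alpha> < pi"
  shows "z \<in> U_dom am ap \<alpha> \<longleftrightarrow>
    am < norm z \<and> (norm z < ap \<or> cos \<alpha> * \<bar>Im z\<bar> < sin \<alpha> * (ap - Re z))"
proof -
  have "z \<in> (\<lambda>w. of_real ap - w) ` cone \<alpha> \<longleftrightarrow> of_real ap - z \<in> cone \<alpha>"
    by (auto intro!: image_eqI[where x = "of_real ap - z"])
  then show ?thesis
    by (auto simp: U_dom_def annulus_def mem_cone_iff[OF assms])
qed

lemma open_U_dom:
  assumes "0 < \<alpha>" "\<alpha> < pi"
  shows "open (U_dom am ap \<alpha>)"
proof -
  have "U_dom am ap \<alpha> = {z. am < norm z} \<inter>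
      ({z. norm z < ap} \<union> {z. cos \<alpha> * \<bar>Im z\<bar> < sin \<alpha> * (ap - Re z)})"
    using mem_U_dom_iff[OF assms] by auto
  then show ?thesis
    by (simp, intro open_Int open_Un open_Collect_less continuous_intros)
qed

lemma neg_exp_mem_U_dom_iff:
  assumes "0 < \<alpha>" "\<alpha> < pi" "\<bar>Im \<zeta>\<bar> \<le> pi"
  shows "- exp \<zeta> \<in> U_dom am ap \<alpha> \<longleftrightarrow>
    am < exp (Re \<zeta>) \<and>
    (exp (Re \<zeta>) < ap \<or> exp (Re \<zeta>) * sin (\<bar>Im \<zeta>\<bar> - \<alpha>) < ap * sin \<alpha>)"
proof -
  have s: "\<bar>sin (Im \<zeta>)\<bar> = sin \<bar>Im \<zeta>\<bar>"
    using assms(3) sin_ge_zero[of "\<bar>Im \<zeta>\<bar>"] by (cases "0 \<le> Im \<zeta>") auto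
  have "cos \<alpha> * \<bar>Im (- exp \<zeta>)\<bar> < sin \<alpha> * (ap - Re (- exp \<zeta>)) \<longleftrightarrow>
      exp (Re \<zeta>) * sin (\<bar>Im \<zeta>\<bar> - \<alpha>) < ap * sin \<alpha>"
    by (simp add: Re_exp Im_exp abs_mult s sin_diff algebra_simps)
  then show ?thesis
    by (simp add: mem_U_dom_iff[OF assms(1,2)] norm_exp_eq_Re)
qed

text \<open>Moving towards the origin or turning towards the negative axis does not leave the domain.
If \<open>\<pi>/2 < \<phi> - \<alpha> \<le> \<pi> - \<alpha>\<close>, then \<open>sin(\<phi> - \<alpha>) \<ge> sin \<alpha>\<close>, so the cone condition fails for \<open>R \<ge> a\<^sub>+\<close>. Hence only the
range where \<open>sin(\<phi> - \<alpha>)\<close> is negative or increases in \<open>\<phi>\<close> matters.\<close>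
lemma U_dom_log_coords_mono:
  assumes "0 < \<alpha>" "\<alpha> < pi" "0 < ap"
    and "0 < R'" "R' \<le> R" "0 \<le> \<phi>'" "\<phi>' \<le> \<phi>" "\<phi> \<le> pi"
    and R: "R < ap \<or> R * sin (\<phi> - \<alpha>) < ap * sin \<alpha>"
  shows "R' < ap \<or> R' * sin (\<phi>' - \<alpha>) < ap * sin \<alpha>"
proof (cases "R' < ap")
  case False
  then have R2: "R * sin (\<phi> - \<alpha>) < ap * sin \<alpha>" and "ap \<le> R" using R assms by auto
  have sa: "0 < sin \<alpha>" using assms by (simp add: sin_gt_zero)
  show ?thesis
  proof (cases "\<phi>' \<le> \<alpha>")
    case True
    then have "sin (\<phi>' - \<alpha>) \<le> 0"
      using sin_ge_zero[of "\<alpha> - \<phi>'"] assms sin_minus[of "\<phi>' - \<alpha>"] by simp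
    then have "R' * sin (\<phi>' - \<alpha>) \<le> 0" using assms by (simp add: mult_nonneg_nonpos)
    also have "0 < ap * sin \<alpha>" using sa assms by simp
    finally show ?thesis by simp
  next
    case above: False
    have "\<phi> - \<alpha> \<le> pi / 2"
    proof (rule ccontr)
      assume "\<not> \<phi> - \<alpha> \<le> pi / 2"
      then have "sin \<alpha> \<le> sin (pi - (\<phi> - \<alpha>))"
        using assms by (intro sin_monotone_2pi_le) auto
      then have "ap * sin \<alpha> \<le> R * sin (\<phi> - \<alpha>)"
        using \<open>ap \<le> R\<close> assms sa by (intro mult_mono) auto
      then show False using R2 by simp
    qed
    then have "sin (\<phi>' - \<alpha>) \<le> sin (\<phi> - \<alpha>)"
      using above assms by (intro sin_monotone_2pi_le) auto
    moreover have "0 \<le> sin (\<phi>' - \<alpha>)"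
      using above assms by (intro sin_ge_zero) auto
    ultimately have "R' * sin (\<phi>' - \<alpha>) \<le> R * sin (\<phi> - \<alpha>)"
      using assms by (intro mult_mono) auto
    then show ?thesis using R2 by simp
  qed
qed simp

text \<open>This carries the growth bound from the two end points of an arc around the negative axis
to the whole arc.\<close>
lemma arc_subset_U_dom:
  assumes "0 < \<alpha>" "\<alpha> < pi" "0 < ap"
    and "- exp \<zeta> \<in> U_dom am ap \<alpha>" "\<bar>Im \<zeta>\<bar> \<le> pi"
    and "Re \<xi> = Re \<zeta>" "\<bar>Im \<xi>\<bar> \<le> \<bar>Im \<zeta>\<bar>"
  shows "- exp \<xi> \<in> U_dom am ap \<alpha>"
  using U_dom_log_coords_mono[of \<alpha> ap "exp (Re \<zeta>)" "exp (Re \<zeta>)" "\<bar>Im \<xi>\<bar>" "\<bar>Im \<zeta>\<bar>"] assms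
  by (auto simp: neg_exp_mem_U_dom_iff)

text \<open>The angles are restricted to \<open>\<bar>Im \<zeta>\<bar> < \<pi>\<close> only beyond the annulus. Over the annulus all of them are
allowed, so that the set contains lifts of full circles and a period can be read off inside it.\<close>
definition log_dom :: "real \<Rightarrow> real \<Rightarrow> real \<Rightarrow> complex set" where
  "log_dom am ap \<alpha> = {\<zeta>. am < exp (Re \<zeta>) \<and> (exp (Re \<zeta>) < ap \<or>
     \<bar>Im \<zeta>\<bar> < pi \<and> exp (Re \<zeta>) * sin (\<bar>Im \<zeta>\<bar> - \<alpha>) < ap * sin \<alpha>)}"

lemma neg_exp_log_dom:
  assumes "0 < \<alpha>" "\<alpha> < pi" "\<zeta> \<in> log_dom am ap \<alpha>"
  shows "- exp \<zeta> \<in> U_dom am ap \<alpha>"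
proof (cases "exp (Re \<zeta>) < ap")
  case True
  then show ?thesis using assms by (simp add: mem_U_dom_iff log_dom_def norm_exp_eq_Re)
next
  case False
  then show ?thesis using assms by (simp add: neg_exp_mem_U_dom_iff log_dom_def)
qed

lemma log_domI:
  assumes "0 < \<alpha>" "\<alpha> < pi" "\<bar>Im \<zeta>\<bar> < pi" "- exp \<zeta> \<in> U_dom am ap \<alpha>"
  shows "\<zeta> \<in> log_dom am ap \<alpha>"
  using assms by (auto simp: neg_exp_mem_U_dom_iff log_dom_def)

lemma open_log_dom: "open (log_dom am ap \<alpha>)"
proof -
  have "log_dom am ap \<alpha> = {\<zeta>. am < exp (Re \<zeta>)} \<inter> ({\<zeta>. exp (Re \<zeta>) < ap} \<union>
     ({\<zeta>. \<bar>Im \<zeta>\<bar> < pi} \<inter> {\<zeta>. exp (Re \<zeta>) * sin (\<bar>Im \<zeta>\<bar> - \<alpha>) < ap * sin \<alpha>}))"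
    by (auto simp: log_dom_def)
  then show ?thesis
    by (simp, intro open_Int open_Un open_Collect_less continuous_intros)
qed

text \<open>Any real \<open>x\<^sub>0\<close> over the annulus is a centre: while a segment from \<open>x\<^sub>0\<close> is beyond the annulus,
its points have neither a larger radius nor a larger angle than its other end point.\<close>
lemma starlike_log_dom:
  assumes "0 < \<alpha>" "\<alpha> < pi" "0 \<le> am" "am < ap"
  shows "starlike (log_dom am ap \<alpha>)"
proof -
  define x0 where "x0 = ln ((am + ap) / 2)"
  have x0: "am < exp x0" "exp x0 < ap" using assms by (auto simp: x0_def)
  have "closed_segment (complex_of_real x0) \<zeta> \<subseteq> log_dom am ap \<alpha>"
    if \<zeta>: "\<zeta> \<in> log_dom am ap \<alpha>" for \<zeta>
  proof
    fix \<xi> assume "\<xi> \<in> closed_segment (complex_of_real x0) \<zeta>"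
    then obtain t where t: "0 \<le> t" "t \<le> 1" and \<xi>: "\<xi> = (1 - t) *\<^sub>R of_real x0 + t *\<^sub>R \<zeta>"
      by (auto simp: closed_segment_def)
    have re: "Re \<xi> = (1 - t) * x0 + t * Re \<zeta>" and im: "\<bar>Im \<xi>\<bar> = t * \<bar>Im \<zeta>\<bar>"
      using t by (auto simp: \<xi> abs_mult)
    have le_max: "Re \<xi> \<le> max x0 (Re \<zeta>)" and ge_min: "min x0 (Re \<zeta>) \<le> Re \<xi>"
      using t convex_bound_le[of x0 "max x0 (Re \<zeta>)" "Re \<zeta>" "1 - t" t]
        convex_bound_le[of "- x0" "- min x0 (Re \<zeta>)" "- Re \<zeta>" "1 - t" t]
      unfolding re by (auto simp: algebra_simps)
    have "am < exp (min x0 (Re \<zeta>))" using x0 \<zeta> by (auto simp: min_def log_dom_def)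
    also have "\<dots> \<le> exp (Re \<xi>)" using ge_min by (simp del: min_le_iff_disj)
    finally have am: "am < exp (Re \<xi>)" .
    have im_le: "\<bar>Im \<xi>\<bar> \<le> \<bar>Im \<zeta>\<bar>" using t im by (simp add: mult_left_le_one_le)
    show "\<xi> \<in> log_dom am ap \<alpha>"
    proof (cases "exp (Re \<xi>) < ap")
      case True
      then show ?thesis using am by (simp add: log_dom_def)
    next
      case False
      then have "exp x0 < exp (Re \<xi>)" using x0 by linarith
      then have "Re \<xi> \<le> Re \<zeta>" using le_max by auto
      then have "exp (Re \<xi>) \<le> exp (Re \<zeta>)" by simp
      moreover from this have \<zeta>': "\<not> exp (Re \<zeta>) < ap" using False by linarith
      moreover have "\<bar>Im \<zeta>\<bar> < pi" using \<zeta> \<zeta>' by (auto simp: log_dom_def)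
      ultimately show ?thesis
        using U_dom_log_coords_mono[of \<alpha> ap "exp (Re \<xi>)" "exp (Re \<zeta>)" "\<bar>Im \<xi>\<bar>" "\<bar>Im \<zeta>\<bar>"]
          assms am im_le \<zeta> False by (auto simp: log_dom_def)
    qed
  qed
  moreover have "complex_of_real x0 \<in> log_dom am ap \<alpha>" using x0 by (simp add: log_dom_def)
  ultimately show ?thesis by (auto simp: starlike_def)
qed

section \<open>Geometry of the sinh curves and of the images of strips\<close>

text \<open>A horizontal line in the parameter plane is mapped to the sinh curve with shifted angle.\<close>
lemma chi_eq_sinh_path: "chi \<sigma> b \<omega> y = sinh_path \<sigma> b (\<omega> + Im y) (Re y)"
proof -
  have "\<i> * complex_of_real \<omega> + y = \<i> * complex_of_real (\<omega> + Im y) + complex_of_real (Re y)"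
    by (simp add: complex_eq_iff)
  then show ?thesis by (simp add: sinh_path_def chi_def)
qed

lemma sinh_path_0: "sinh_path \<sigma> b \<omega> 0 = of_real (\<sigma> - b * sin \<omega>)"
  by (simp add: complex_eq_iff sinh_path_Re_Im)

text \<open>With \<open>C = cosh y\<close>, the square of the norm minus the square of the left-hand side is
\<open>b (C - 1) (b (C - 1) + 2 (b - \<sigma> sin \<omega>))\<close>.\<close>
lemma norm_sinh_path_ge:
  assumes "0 < b" "\<sigma> * sin \<omega> \<le> b"
  shows "\<sigma> - b * sin \<omega> \<le> norm (sinh_path \<sigma> b \<omega> y)"
proof (rule power2_le_imp_le)
  define C where "C = cosh y"
  have C: "1 \<le> C" by (simp add: C_def cosh_real_ge_1)
  have "(norm (sinh_path \<sigma> b \<omega> y))\<^sup>2 =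
      (\<sigma> - b * sin \<omega> * C)\<^sup>2 + b\<^sup>2 * (cos \<omega>)\<^sup>2 * (C\<^sup>2 - 1)"
    by (simp add: cmod_power2 sinh_path_Re_Im C_def sinh_square_eq power_mult_distrib)
  also have "\<dots> = (\<sigma> - b * sin \<omega>)\<^sup>2 + (C - 1) * b * ((C - 1) * b + 2 * (b - \<sigma> * sin \<omega>))"
    unfolding cos_squared_eq by (simp add: power2_eq_square algebra_simps)
  finally have "(norm (sinh_path \<sigma> b \<omega> y))\<^sup>2 =
      (\<sigma> - b * sin \<omega>)\<^sup>2 + (C - 1) * b * ((C - 1) * b + 2 * (b - \<sigma> * sin \<omega>))" .
  moreover have "0 \<le> (C - 1) * b * ((C - 1) * b + 2 * (b - \<sigma> * sin \<omega>))"
    using assms C by (intro mult_nonneg_nonneg add_nonneg_nonneg) auto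
  ultimately show "(\<sigma> - b * sin \<omega>)\<^sup>2 \<le> (norm (sinh_path \<sigma> b \<omega> y))\<^sup>2" by linarith
qed simp

lemma sin_sq_less_1:
  assumes "- (pi/2) < \<omega>" "\<omega> < pi/2"
  shows "(sin \<omega>)\<^sup>2 < 1"
  using cos_gt_zero_pi[of \<omega>] assms by (simp add: sin_squared_eq)

text \<open>For nonpositive angles the condition under which the vertex is the nearest point to the
origin holds as soon as the vertex is not left of the origin, even if \<open>\<sigma> < 0\<close>.\<close>
lemma sigma_sin_less:
  fixes b \<sigma> \<omega> :: real
  assumes "0 < b" "- (pi/2) < \<omega>" "\<omega> \<le> 0" "b * sin \<omega> \<le> \<sigma>"
  shows "\<sigma> * sin \<omega> < b"
proof -
  have "sin \<omega> \<le> 0" using sin_ge_zero[of "-\<omega>"] assms by simp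
  then have "\<sigma> * sin \<omega> \<le> b * sin \<omega> * sin \<omega>"
    using assms(4) by (rule mult_right_mono_neg[rotated])
  also have "\<dots> = b * (sin \<omega>)\<^sup>2" by (simp add: power2_eq_square)
  also have "\<dots> < b" using sin_sq_less_1[of \<omega>] assms by simp
  finally show ?thesis .
qed

lemma infdist_sinh_curve:
  assumes "0 < b" "\<sigma> * sin \<omega> \<le> b" "0 \<le> \<sigma> - b * sin \<omega>"
  shows "infdist 0 (sinh_curve \<sigma> b \<omega>) = \<sigma> - b * sin \<omega>"
proof (rule antisym)
  have "sinh_path \<sigma> b \<omega> 0 \<in> sinh_curve \<sigma> b \<omega>" by (simp add: sinh_curve_def)
  then show "infdist 0 (sinh_curve \<sigma> b \<omega>) \<le> \<sigma> - b * sin \<omega>"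
    by (rule infdist_le2) (use assms in \<open>simp add: sinh_path_0 flip: of_real_mult of_real_diff\<close>)
  have "sinh_curve \<sigma> b \<omega> \<noteq> {}" by (simp add: sinh_curve_def)
  then show "\<sigma> - b * sin \<omega> \<le> infdist 0 (sinh_curve \<sigma> b \<omega>)"
    using norm_sinh_path_ge[OF assms(1,2)]
    by (auto simp: infdist_notempty sinh_curve_def intro!: cINF_greatest)
qed

lemma ex_vertex:
  assumes "- (pi/2) < \<omega>" "\<omega> < pi/2" "0 \<le> am" "am < ap"
  shows "\<exists>\<sigma>>0. \<exists>b>0. b > \<sigma> * sin \<omega> \<and> \<sigma> - b * sin \<omega> \<in> {am <..< ap}"
proof -
  define x where "x = (am + ap) / 2"
  have x: "0 < x" "am < x" "x < ap" using assms by (auto simp: x_def)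
  have c: "0 < (cos \<omega>)\<^sup>2" using cos_gt_zero_pi[of \<omega>] assms by simp
  \<comment> \<open>For \<open>\<sigma> = x + b sin \<omega>\<close> the first condition reads \<open>x sin \<omega> < b cos\<^sup>2 \<omega>\<close>, so \<open>b\<close> has to be large if
  \<open>sin \<omega> > 0\<close>. If \<open>sin \<omega> \<le> 0\<close>, it has to be small, to keep \<open>\<sigma>\<close> positive.\<close>
  define b where "b = (if sin \<omega> \<le> 0 then x / 2 else x / (cos \<omega>)\<^sup>2)"
  have b: "0 < b" using x c by (auto simp: b_def)
  have "0 < x + b * sin \<omega> \<and> (x + b * sin \<omega>) * sin \<omega> < b"
  proof (cases "sin \<omega> \<le> 0")
    case True
    have "x * (- sin \<omega>) \<le> x * 1" using x sin_ge_minus_one[of \<omega>] by (intro mult_left_mono) linarith+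
    then have "0 < x + b * sin \<omega>" using True x by (simp add: b_def)
    moreover from this have "(x + b * sin \<omega>) * sin \<omega> \<le> 0"
      using True by (intro mult_nonneg_nonpos) auto
    ultimately show ?thesis using b by linarith
  next
    case False
    have "sin \<omega> < 1"
      using sin_sq_less_1[OF assms(1,2)] False by (simp add: abs_square_less_1)
    then have "x * sin \<omega> < x" using x by simp
    also have "x = b * (cos \<omega>)\<^sup>2" using False c by (simp add: b_def)
    also have "\<dots> = b - b * sin \<omega> * sin \<omega>"
      unfolding cos_squared_eq by (simp add: power2_eq_square algebra_simps)
    finally show ?thesis using x b False by (simp add: algebra_simps add_pos_pos)
  qed
  then show ?thesis
    using x b by (intro exI[of _ "x + b * sin \<omega>"] conjI exI[of _ b]) auto
qed

lemma cosh_minus_1_le_abs_sinh: "cosh y - 1 \<le> \<bar>sinh (y::real)\<bar>"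
proof (rule power2_le_imp_le)
  define D where "D = cosh y - 1"
  have "(sinh y)\<^sup>2 = D\<^sup>2 + 2 * D"
    unfolding sinh_square_eq D_def by (simp add: power2_eq_square algebra_simps)
  moreover have "0 \<le> D" using cosh_real_ge_1[of y] by (simp add: D_def)
  ultimately show "(cosh y - 1)\<^sup>2 \<le> \<bar>sinh y\<bar>\<^sup>2" by (simp flip: D_def)
qed simp

lemma abs_sinh_le_cosh: "\<bar>sinh (y::real)\<bar> \<le> cosh y"
  by (rule power2_le_imp_le) (simp_all add: sinh_square_eq)

text \<open>The vertex lies left of \<open>a\<^sub>+\<close>. Relative to the vertex the curve moves by
\<open>- b sin \<omega> (C - 1)\<close> horizontally and by \<open>b cos \<omega> S\<close>, up to sign, vertically, where \<open>C = cosh y\<close> and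
\<open>S = \<bar>sinh y\<bar> \<ge> C - 1\<close>. The negative of this displacement lies in the closed cone since \<open>cos \<alpha> \<le> 0\<close>
and \<open>cos(\<alpha> + \<omega>) \<le> 0\<close>. For acute \<open>\<alpha>\<close> the first sign changes
and the argument breaks down near the vertex.\<close>
lemma sinh_curve_subset_U_dom:
  assumes "pi/2 \<le> \<alpha>" "\<alpha> < pi" "\<omega> \<in> {pi/2 - \<alpha> <..< pi/2}" "0 < b" "\<sigma> * sin \<omega> < b"
    "\<sigma> - b * sin \<omega> \<in> {am <..< ap}"
  shows "sinh_curve \<sigma> b \<omega> \<subseteq> U_dom am ap \<alpha>"
proof -
  have \<alpha>: "0 < \<alpha>" using assms(1) pi_gt_zero by linarith
  have "sinh_path \<sigma> b \<omega> y \<in> U_dom am ap \<alpha>" for y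
  proof -
    define C S where "C = cosh y" and "S = \<bar>sinh y\<bar>"
    have CS: "C - 1 \<le> S" "1 \<le> C"
      by (simp_all add: C_def S_def cosh_minus_1_le_abs_sinh cosh_real_ge_1)
    have c: "0 < cos \<omega>" using assms \<alpha> by (intro cos_gt_zero_pi) auto
    have ca: "cos \<alpha> \<le> 0"
      using cos_monotone_0_pi_le[of "pi/2" \<alpha>] assms by simp
    have sa: "0 < sin \<alpha>" using \<alpha> assms by (simp add: sin_gt_zero)
    have neg: "cos (\<alpha> + \<omega>) \<le> 0"
    proof -
      have "0 \<le> cos (\<alpha> + \<omega> - pi)" using assms by (intro cos_ge_zero) auto
      then show ?thesis by (simp add: cos_diff)
    qed
    have "am < norm (sinh_path \<sigma> b \<omega> y)"
      using norm_sinh_path_ge[of b \<sigma> \<omega> y] assms by auto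
    moreover have "cos \<alpha> * (b * cos \<omega> * S) < sin \<alpha> * (ap - (\<sigma> - b * sin \<omega> * C))"
    proof -
      have "cos \<alpha> * (b * cos \<omega>) * S \<le> cos \<alpha> * (b * cos \<omega>) * (C - 1)"
        using ca c assms CS by (intro mult_left_mono_neg mult_nonpos_nonneg) auto
      also have "\<dots> = b * (C - 1) * cos (\<alpha> + \<omega>) + sin \<alpha> * (b * sin \<omega> * (C - 1))"
        by (simp add: cos_add algebra_simps)
      also have "\<dots> \<le> sin \<alpha> * (b * sin \<omega> * (C - 1))"
        using neg CS assms by (simp add: mult_nonneg_nonpos)
      also have "\<dots> < sin \<alpha> * (b * sin \<omega> * (C - 1) + (ap - (\<sigma> - b * sin \<omega>)))"
        using sa assms by simp
      finally show ?thesis by (simp add: algebra_simps)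
    qed
    ultimately show ?thesis
      using c assms by (simp add: mem_U_dom_iff[OF \<alpha> assms(2)] sinh_path_Re_Im abs_mult C_def S_def)
  qed
  then show ?thesis by (auto simp: sinh_curve_def)
qed

text \<open>Acute or obtuse, the cone contains the far part of the curve if \<open>cos(\<alpha> + \<omega>) < 0\<close>. After replacing \<open>\<bar>sinh y\<bar>\<close> by \<open>cosh y\<close>
at the cost of at most \<open>b\<close>, the cone condition has the leading term \<open>- b cos(\<alpha> + \<omega>) cosh y\<close>. The
explicit threshold makes the statement uniform in \<open>\<omega>\<close>.\<close>
lemma sinh_path_tail_in_U_dom:
  assumes "0 < \<alpha>" "\<alpha> < pi" "0 < b" "- (pi/2) < \<omega>" "\<omega> < pi/2"
    and "am < norm (sinh_path \<sigma> b \<omega> y)"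
    and far: "b + \<bar>ap - \<sigma>\<bar> < b * (- cos (\<alpha> + \<omega>)) * cosh y"
  shows "sinh_path \<sigma> b \<omega> y \<in> U_dom am ap \<alpha>"
proof -
  define C S where "C = cosh y" and "S = \<bar>sinh y\<bar>"
  have CS: "0 \<le> C - S" "C - S \<le> 1"
    using cosh_minus_1_le_abs_sinh[of y] abs_sinh_le_cosh[of y] by (auto simp: C_def S_def)
  have c: "0 < cos \<omega>" using assms by (intro cos_gt_zero_pi)
  have "- cos \<alpha> * cos \<omega> \<le> 1 * 1"
    using c minus_le_iff[of 1 "cos \<alpha>"] cos_ge_minus_one[of \<alpha>] by (intro mult_mono) auto
  then have "(- cos \<alpha> * cos \<omega>) * (C - S) \<le> 1 * (C - S)"
    using CS by (intro mult_right_mono) auto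
  then have "cos \<alpha> * cos \<omega> * S \<le> cos \<alpha> * cos \<omega> * C + 1"
    using CS by (simp add: algebra_simps)
  then have "b * (cos \<alpha> * cos \<omega> * S) \<le> b * (cos \<alpha> * cos \<omega> * C + 1)"
    using assms by (intro mult_left_mono) auto
  also have "\<dots> = b - b * (- cos (\<alpha> + \<omega>)) * C + sin \<alpha> * (b * sin \<omega> * C)"
    by (simp add: cos_add algebra_simps)
  also have "\<dots> < - \<bar>ap - \<sigma>\<bar> + sin \<alpha> * (b * sin \<omega> * C)"
    using far by (simp add: C_def)
  also have "- \<bar>ap - \<sigma>\<bar> \<le> sin \<alpha> * (ap - \<sigma>)"
  proof -
    have "\<bar>sin \<alpha>\<bar> * \<bar>ap - \<sigma>\<bar> \<le> 1 * \<bar>ap - \<sigma>\<bar>" by (intro mult_right_mono) auto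
    then show ?thesis
      unfolding abs_mult[symmetric] using abs_le_D2 by fastforce
  qed
  finally have "cos \<alpha> * (b * cos \<omega> * S) < sin \<alpha> * (ap - (\<sigma> - b * sin \<omega> * C))"
    by (simp add: algebra_simps)
  then show ?thesis
    using c assms by (simp add: mem_U_dom_iff[OF assms(1,2)] sinh_path_Re_Im abs_mult C_def S_def)
qed

lemma cos_add_neg:
  assumes "0 < \<alpha>" "\<alpha> < pi" "pi/2 - \<alpha> < \<omega>" "\<omega> < pi/2"
  shows "cos (\<alpha> + \<omega>) < 0"
proof -
  have "0 < cos (\<alpha> + \<omega> - pi)" using assms by (intro cos_gt_zero_pi) auto
  then show ?thesis by (simp add: cos_diff)
qed

lemma exp_abs_le_cosh: "exp \<bar>y\<bar> / 2 \<le> cosh (y::real)"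
  by (cases "0 \<le> y") (auto simp: cosh_field_def)

text \<open>The part of the curve over a compact interval has a neighbourhood that is mapped into the
open domain. The tails of all curves with nearby angle are in the domain beyond a common
parameter \<open>Y\<close>.\<close>
lemma ex_strip_subset_U_dom:
  assumes "0 < \<alpha>" "\<alpha> < pi" "pi/2 - \<alpha> < \<omega>" "\<omega> < pi/2" "0 < b" "\<sigma> * sin \<omega> < b"
    "am < \<sigma> - b * sin \<omega>"
    and inside: "sinh_curve \<sigma> b \<omega> \<subseteq> U_dom am ap \<alpha>"
  shows "\<exists>d0>0. chi \<sigma> b \<omega> ` strip d0 \<subseteq> U_dom am ap \<alpha>"
proof -
  define \<kappa> where "\<kappa> = - cos (\<alpha> + \<omega>) / 2"
  have \<kappa>: "0 < \<kappa>" "\<kappa> < - cos (\<alpha> + \<omega>)" using cos_add_neg[of \<alpha> \<omega>] assms by (auto simp: \<kappa>_def)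
  define N where "N = {w. pi/2 - \<alpha> < w} \<inter> {w. w < pi/2} \<inter> {w. \<sigma> * sin w < b} \<inter>
    {w. am < \<sigma> - b * sin w} \<inter> {w. \<kappa> < - cos (\<alpha> + w)}"
  have "open N" unfolding N_def by (intro open_Int open_Collect_less continuous_intros)
  moreover have "\<omega> \<in> N" using assms \<kappa> by (simp add: N_def)
  ultimately obtain e where e: "0 < e" "ball \<omega> e \<subseteq> N" by (meson open_contains_ball)
  define Y where "Y = 2 * (b + \<bar>ap - \<sigma>\<bar>) / (b * \<kappa>)"
  have far: "b + \<bar>ap - \<sigma>\<bar> < b * (- cos (\<alpha> + w)) * cosh x" if "w \<in> N" "Y \<le> \<bar>x\<bar>" for w x
  proof -
    have "Y < exp \<bar>x\<bar>" using that exp_ge_add_one_self[of "\<bar>x\<bar>"] by linarith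
    then have "2 * (b + \<bar>ap - \<sigma>\<bar>) < b * \<kappa> * exp \<bar>x\<bar>"
      using assms \<kappa> by (simp add: Y_def field_simps)
    also have "\<dots> \<le> b * \<kappa> * (2 * cosh x)"
      using assms \<kappa> exp_abs_le_cosh[of x] by (intro mult_left_mono) auto
    also have "\<dots> \<le> b * (- cos (\<alpha> + w)) * (2 * cosh x)"
      using that assms by (intro mult_right_mono mult_left_mono) (auto simp: N_def)
    finally show ?thesis by simp
  qed
  define K where "K = complex_of_real ` {-Y..Y}"
  define V where "V = chi \<sigma> b \<omega> -` U_dom am ap \<alpha>"
  have "open V" unfolding V_def
    by (rule open_vimage[OF open_U_dom[OF assms(1,2)]])
      (simp add: chi_def[abs_def] sinh_field_def, intro continuous_intros, auto)
  moreover have "compact K" unfolding K_def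
    by (intro compact_continuous_image continuous_intros) auto
  moreover have "K \<subseteq> V"
    using inside by (auto simp: K_def V_def sinh_curve_def sinh_path_def)
  ultimately obtain e' where e': "0 < e'" "(\<Union>x\<in>K. ball x e') \<subseteq> V"
    by (metis compact_subset_open_imp_ball_epsilon_subset)
  have "chi \<sigma> b \<omega> y \<in> U_dom am ap \<alpha>" if y: "\<bar>Im y\<bar> < min e e'" for y
  proof (cases "\<bar>Re y\<bar> \<le> Y")
    case True
    then have "complex_of_real (Re y) \<in> K" unfolding K_def by (intro imageI) auto
    moreover have "y \<in> ball (complex_of_real (Re y)) e'"
      using y by (simp add: dist_norm cmod_def)
    ultimately have "y \<in> V" using e' by blast
    then show ?thesis by (simp add: V_def)
  next
    case False
    have "\<omega> + Im y \<in> N" using y e(2) by (auto simp: dist_real_def)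
    then show ?thesis
      using assms False far[of "\<omega> + Im y" "Re y"] norm_sinh_path_ge[of b \<sigma> "\<omega> + Im y" "Re y"]
      unfolding chi_eq_sinh_path
      by (intro sinh_path_tail_in_U_dom) (auto simp: N_def)
  qed
  then show ?thesis
    using e(1) e'(1) by (intro exI[of _ "min e e'"]) (auto simp: strip_def)
qed

text \<open>Among the curves with angle in \<open>(\<omega> - d, \<omega> + d)\<close> those with the largest angles come nearest
to the origin, at their vertices. The strip being open, the infimum is only approached.\<close>
lemma ex_infdist_strip:
  assumes "- (pi/2) < \<omega>" "\<omega> < pi/2" "0 < b" "\<sigma> * sin \<omega> < b" "0 < \<sigma> - b * sin \<omega>"
  shows "\<exists>d0>0. \<forall>d. 0 < d \<longrightarrow> d < d0 \<longrightarrow>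
    infdist 0 (chi \<sigma> b \<omega> ` strip d) = \<sigma> - b * sin (\<omega> + d)"
proof -
  define N where "N = {w. - (pi/2) < w} \<inter> {w. w < pi/2} \<inter> {w. \<sigma> * sin w < b} \<inter>
    {w. 0 < \<sigma> - b * sin w}"
  have "open N" unfolding N_def by (intro open_Int open_Collect_less continuous_intros)
  moreover have "\<omega> \<in> N" using assms by (simp add: N_def)
  ultimately obtain e where e: "0 < e" "ball \<omega> e \<subseteq> N" by (meson open_contains_ball)
  have "infdist 0 (chi \<sigma> b \<omega> ` strip d) = \<sigma> - b * sin (\<omega> + d)" if d: "0 < d" "d < e" for d
  proof (rule antisym)
    have N: "\<omega> + t \<in> N" if "\<bar>t\<bar> < e" for t using that e by (auto simp: dist_real_def)
    show "\<sigma> - b * sin (\<omega> + d) \<le> infdist 0 (chi \<sigma> b \<omega> ` strip d)"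
    proof -
      have "\<sigma> - b * sin (\<omega> + d) \<le> norm (chi \<sigma> b \<omega> y)" if y: "\<bar>Im y\<bar> < d" for y
      proof -
        have w: "\<omega> + Im y \<in> N" "\<omega> + d \<in> N" using N[of "Im y"] N[of d] y d by auto
        then have "sin (\<omega> + Im y) \<le> sin (\<omega> + d)"
          using y by (intro sin_monotone_2pi_le) (auto simp: N_def)
        then have "\<sigma> - b * sin (\<omega> + d) \<le> \<sigma> - b * sin (\<omega> + Im y)" using assms by simp
        also have "\<dots> \<le> norm (chi \<sigma> b \<omega> y)"
          unfolding chi_eq_sinh_path using assms w by (intro norm_sinh_path_ge) (auto simp: N_def)
        finally show ?thesis .
      qed
      moreover have "(0::complex) \<in> strip d" using d by (simp add: strip_def)
      then have "chi \<sigma> b \<omega> ` strip d \<noteq> {}" by blast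
      ultimately show ?thesis
        by (auto simp: infdist_notempty strip_def intro!: cINF_greatest)
    qed
    show "infdist 0 (chi \<sigma> b \<omega> ` strip d) \<le> \<sigma> - b * sin (\<omega> + d)"
    proof (rule tendsto_lowerbound)
      show "((\<lambda>t. \<sigma> - b * sin (\<omega> + t)) \<longlongrightarrow> \<sigma> - b * sin (\<omega> + d)) (at_left d)"
        by (intro tendsto_intros)
      have "\<forall>\<^sub>F t in at_left d. 0 < t \<and> t < d"
        using d by (simp add: eventually_at_left_real eventually_at_left_field) (meson d)
      then show "\<forall>\<^sub>F t in at_left d. infdist 0 (chi \<sigma> b \<omega> ` strip d) \<le> \<sigma> - b * sin (\<omega> + t)"
      proof eventually_elim
        case (elim t)
        have "chi \<sigma> b \<omega> (\<i> * of_real t) \<in> chi \<sigma> b \<omega> ` strip d"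
          using elim by (intro imageI) (simp add: strip_def)
        moreover have "chi \<sigma> b \<omega> (\<i> * of_real t) = of_real (\<sigma> - b * sin (\<omega> + t))"
          by (simp add: chi_eq_sinh_path sinh_path_0)
        moreover have "0 < \<sigma> - b * sin (\<omega> + t)" using N[of t] elim d by (auto simp: N_def)
        ultimately show ?case
          using infdist_le[of "chi \<sigma> b \<omega> (\<i> * of_real t)" "chi \<sigma> b \<omega> ` strip d" 0]
          by (simp del: of_real_diff of_real_mult)
      qed
    qed simp
  qed
  then show ?thesis using e(1) by blast
qed

section \<open>Primitives in logarithmic coordinates and their period\<close>

text \<open>Orthogonality of the powers on the unit circle, parametrized by the angle to the negative
axis as everywhere below.\<close>
lemma integral_powi_neg_exp_circle:
  fixes k :: int
  shows "((\<lambda>t. (- exp (\<i> * of_real t)) powi k) has_integral (if k = 0 then 2 * of_real pi else 0)) {- pi .. pi}"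
proof (cases "k = 0")
  case True
  then show ?thesis
    using has_integral_const_real[of "1::complex" "- pi" pi] by (simp add: scaleR_conv_of_real)
next
  case False
  define F where "F = (\<lambda>z. (- exp (\<i> * z)) powi k / (\<i> * of_int k))"
  have F: "(F has_field_derivative (- exp (\<i> * z)) powi k) (at z)" for z
    unfolding F_def using False
    by (auto intro!: derivative_eq_intros simp: field_simps power_int_diff)
  have "((\<lambda>t. (- exp (\<i> * of_real t)) powi k) has_integral
      F (of_real pi) - F (of_real (- pi))) {- pi .. pi}"
    by (rule fundamental_theorem_of_calculus)
      (auto intro!: has_vector_derivative_real_field F)
  then show ?thesis using False by (simp add: F_def exp_minus)
qed

text \<open>Absolute summability makes the series converge uniformly on the circle, so that it can be
integrated term by term.\<close>
lemma Z_transform_coefficient: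
  assumes "(\<lambda>k. norm (u k)) summable_on UNIV"
  shows "((\<lambda>t. Z_transform u (- exp (\<i> * of_real t)) * (- exp (\<i> * of_real t)) powi (- n))
    has_integral 2 * of_real pi * u n) {- pi .. pi}"
proof -
  define e where "e = (\<lambda>t. - exp (\<i> * complex_of_real t))"
  have e: "norm (e t) = 1" "e t \<noteq> 0" for t by (simp_all add: e_def)
  define c where "c = (\<lambda>k t. u k * e t powi (k - n))"
  have nc: "norm (c k t) = norm (u k)" for k t
    by (simp add: c_def norm_mult norm_power_int e)
  have c_eq: "c k t = u k * e t powi k * e t powi (- n)" for k t
    using power_int_add[of "e t" k "- n"] e by (simp add: c_def mult.assoc)
  have "Z_transform u (e t) * e t powi (- n) = (\<Sum>\<^sub>\<infinity>k. c k t)" for t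
  proof -
    have "(\<lambda>k. u k * e t powi k) summable_on UNIV"
      by (rule abs_summable_summable) (use assms in \<open>simp add: norm_mult norm_power_int e\<close>)
    then show ?thesis
      unfolding Z_transform_def c_eq by (rule infsum_cmult_left[symmetric])
  qed
  moreover have "uniform_limit {- pi..pi} (\<lambda>K t. \<Sum>k\<in>K. c k t) (\<lambda>t. \<Sum>\<^sub>\<infinity>k. c k t)
      (finite_subsets_at_top UNIV)"
    using assms
    by (intro Weierstrass_m_test_general[where M = "\<lambda>k. norm (u k)"]) (simp_all add: nc)
  ultimately have ul: "uniform_limit {- pi..pi} (\<lambda>K t. \<Sum>k\<in>K. c k t)
      (\<lambda>t. Z_transform u (e t) * e t powi (- n)) (finite_subsets_at_top UNIV)"
    by simp
  obtain I J where IJ: "\<And>K. ((\<lambda>t. \<Sum>k\<in>K. c k t) has_integral I K) {- pi..pi}"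
      "((\<lambda>t. Z_transform u (e t) * e t powi (- n)) has_integral J) {- pi..pi}"
      "(I \<longlongrightarrow> J) (finite_subsets_at_top UNIV)"
    by (rule uniform_limit_integral[OF ul])
      (auto simp: c_def e_def intro!: continuous_intros)
  have c_int: "(c k has_integral (if k = n then 2 * of_real pi * u n else 0)) {- pi..pi}" for k
    using has_integral_mult_right[OF integral_powi_neg_exp_circle[of "k - n"], of "u k"]
    by (cases "k = n") (auto simp: c_def[abs_def] e_def mult.commute)
  have "I K = 2 * of_real pi * u n" if "finite K" "{n} \<subseteq> K" for K
  proof -
    have "((\<lambda>t. \<Sum>k\<in>K. c k t) has_integral (\<Sum>k\<in>K. if k = n then 2 * of_real pi * u n else 0)) {- pi..pi}"
      using that(1) c_int by (rule has_integral_sum)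
    then show ?thesis using IJ(1)[of K] that by (auto dest: has_integral_unique)
  qed
  then have "\<forall>\<^sub>F K in finite_subsets_at_top UNIV. I K = 2 * of_real pi * u n"
    unfolding eventually_finite_subsets_at_top by (metis finite.emptyI finite.insertI subset_UNIV)
  then have "(I \<longlongrightarrow> 2 * of_real pi * u n) (finite_subsets_at_top UNIV)"
    by (rule tendsto_eventually)
  then have "J = 2 * of_real pi * u n"
    using IJ(3) by (intro tendsto_unique[of "finite_subsets_at_top UNIV"]) auto
  then show ?thesis using IJ(2) by (simp add: e_def)
qed

lemma ex_log_dom_primitive:
  assumes "0 < \<alpha>" "\<alpha> < pi" "0 \<le> am" "am < ap" "f holomorphic_on U_dom am ap \<alpha>"
  obtains \<Phi> where "\<And>\<zeta>. \<zeta> \<in> log_dom am ap \<alpha> \<Longrightarrow>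
    (\<Phi> has_field_derivative f (- exp \<zeta>) / (- exp \<zeta>) ^ n) (at \<zeta>)"
proof -
  let ?G = "\<lambda>\<zeta>. f (- exp \<zeta>) / (- exp \<zeta>) ^ n"
  have "(f \<circ> (\<lambda>\<zeta>. - exp \<zeta>)) holomorphic_on log_dom am ap \<alpha>"
    by (rule holomorphic_on_compose_gen[OF _ assms(5)])
      (auto intro!: holomorphic_intros neg_exp_log_dom assms)
  then have hol: "?G holomorphic_on log_dom am ap \<alpha>"
    by (intro holomorphic_on_divide) (auto intro!: holomorphic_intros simp: o_def)
  then have "\<exists>\<Phi>. \<forall>\<zeta>\<in>log_dom am ap \<alpha>. (\<Phi> has_field_derivative ?G \<zeta>) (at \<zeta>)"
    using starlike_log_dom[OF assms(1-4)] open_log_dom[of am ap \<alpha>]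
    by (intro holomorphic_starlike_primitive[where k = "{}"] holomorphic_on_imp_continuous_on)
      (auto simp: holomorphic_on_imp_differentiable_at)
  then show ?thesis using that by blast
qed

text \<open>The difference \<open>P\<close> of the values of \<open>\<Phi>\<close> at distance \<open>2\<pi>i\<close> has derivative \<open>0\<close> on the convex strip over
the annulus. Its constant value is the integral over any circle with radius less than \<open>1\<close> in the
annulus. Continuity up to the unit circle from inside is all that is available when \<open>a\<^sub>+ = 1\<close>,
and it suffices to pass to radius \<open>1\<close>, where the integral is a Fourier coefficient.\<close>
lemma primitive_period:
  assumes "0 \<le> am" "am < 1" "1 \<le> ap"
    and l1: "(\<lambda>k. norm (u k)) summable_on UNIV"
    and f: "continues_Z_transform f u am ap \<alpha>"
    and \<Phi>: "\<And>\<zeta>. \<zeta> \<in> log_dom am ap \<alpha> \<Longrightarrow>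
      (\<Phi> has_field_derivative f (- exp \<zeta>) / (- exp \<zeta>) ^ n) (at \<zeta>)"
    and \<zeta>: "am < exp (Re \<zeta>)" "exp (Re \<zeta>) < ap"
  shows "\<Phi> (\<zeta> + \<i> * of_real pi) - \<Phi> (\<zeta> - \<i> * of_real pi) = 2 * of_real pi * \<i> * u (int n)"
proof -
  define G where "G = (\<lambda>\<zeta>. f (- exp \<zeta>) / (- exp \<zeta>) ^ n)"
  define T where "T = {\<zeta>. am < exp (Re \<zeta>) \<and> exp (Re \<zeta>) < ap}"
  define P where "P = (\<lambda>\<zeta>. \<Phi> (\<zeta> + \<i> * of_real pi) - \<Phi> (\<zeta> - \<i> * of_real pi))"
  have \<Phi>_T: "(\<Phi> has_field_derivative G \<xi>) (at \<xi>)" if "am < exp (Re \<xi>)" "exp (Re \<xi>) < ap" for \<xi>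
    using \<Phi>[of \<xi>] that by (simp add: log_dom_def G_def)
  have "convex {x. am < exp x \<and> exp x < ap}"
    by (rule is_interval_convex) (auto simp: is_interval_1 intro: less_le_trans le_less_trans)
  then have "convex (Re -` {x. am < exp x \<and> exp x < ap})"
    by (rule convex_linear_vimage[OF bounded_linear.linear[OF bounded_linear_Re]])
  then have "convex T" by (simp add: T_def vimage_def)
  moreover have "(P has_field_derivative 0) (at \<xi> within T)" if "\<xi> \<in> T" for \<xi>
  proof -
    have shift: "((\<lambda>\<xi>. \<Phi> (\<xi> + of_real s * \<i>)) has_field_derivative G (\<xi> + of_real s * \<i>)) (at \<xi>)"
      for s
    proof -
      have "((\<lambda>\<xi>. \<xi> + of_real s * \<i>) has_field_derivative 1) (at \<xi>)"
        by (auto intro!: derivative_eq_intros)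
      from DERIV_chain2[OF \<Phi>_T this] show ?thesis using that by (simp add: T_def)
    qed
    have "(P has_field_derivative
        (G (\<xi> + \<i> * of_real pi) - G (\<xi> - \<i> * of_real pi))) (at \<xi>)"
      using DERIV_diff[OF shift[of pi] shift[of "- pi"]] by (simp add: P_def[abs_def] mult.commute)
    moreover have "G (\<xi> + \<i> * of_real pi) = G (\<xi> - \<i> * of_real pi)"
      by (simp add: G_def exp_add exp_diff)
    ultimately show ?thesis by (auto intro: has_field_derivative_at_within)
  qed
  ultimately obtain p where p: "\<And>\<xi>. \<xi> \<in> T \<Longrightarrow> P \<xi> = p"
    by (metis has_field_derivative_zero_constant)
  \<comment> \<open>Logarithms of the radii of the circles in the annulus up to the unit circle.\<close>
  define X where "X = {x. am < exp x \<and> x \<le> 0}"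
  define h where "h = (\<lambda>x t. G (of_real x + \<i> * of_real t))"
  have "continuous_on {z. am < norm z \<and> norm z \<le> 1} f"
    using f by (simp add: continues_Z_transform_def)
  moreover have w: "continuous_on (X \<times> cbox (- pi) pi)
      (\<lambda>q. - exp (complex_of_real (fst q) + \<i> * of_real (snd q)))"
    by (intro continuous_intros)
  ultimately have "continuous_on (X \<times> cbox (- pi) pi)
      (\<lambda>q. f (- exp (complex_of_real (fst q) + \<i> * of_real (snd q))))"
    by (rule continuous_on_compose2) (auto simp: X_def norm_exp_eq_Re)
  then have "continuous_on (X \<times> cbox (- pi) pi) (\<lambda>(x, t). h x t)"
    unfolding h_def G_def case_prod_unfold
    by (rule continuous_on_divide[OF _ continuous_on_power[OF w]]) auto
  then have I: "continuous_on X (\<lambda>x. integral (cbox (- pi) pi) (h x))"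
    by (rule integral_continuous_on_param)
  have int_h: "\<i> * integral (cbox (- pi) pi) (h x) = p" if x: "am < exp x" "exp x < ap" for x
  proof -
    have "((\<lambda>t. \<i> * h x t) has_integral
        \<Phi> (of_real x + \<i> * of_real pi) - \<Phi> (of_real x + \<i> * of_real (- pi))) {- pi..pi}"
    proof (rule fundamental_theorem_of_calculus)
      fix t :: real
      have "((\<lambda>w. of_real x + \<i> * w) has_field_derivative \<i>) (at (of_real t))"
        by (auto intro!: derivative_eq_intros)
      from DERIV_chain2[OF \<Phi>_T this]
      have "((\<lambda>w. \<Phi> (of_real x + \<i> * w)) has_field_derivative \<i> * h x t) (at (of_real t))"
        using x by (simp add: h_def mult.commute)
      then show "((\<lambda>t. \<Phi> (of_real x + \<i> * of_real t)) has_vector_derivative \<i> * h x t)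
          (at t within {- pi..pi})"
        by (rule has_vector_derivative_real_field)
    qed simp
    from integral_unique[OF this]
    have "integral {- pi..pi} (\<lambda>t. \<i> * h x t) = P (of_real x)"
      by (simp add: P_def)
    then show ?thesis using p[of "of_real x"] x by (simp add: T_def)
  qed
  have "\<i> * integral (cbox (- pi) pi) (h 0) = p"
  proof -
    \<comment> \<open>The interval \<open>[-e, 0]\<close> contains the logarithms of the radii from \<open>(a\<^sub>- + 1)/2\<close> to \<open>1\<close>.\<close>
    define e where "e = ln (2 / (am + 1))"
    have e: "0 < e" "am < exp (- e)" using assms(1,2) by (auto simp: e_def exp_minus)
    have X: "{- e..0} \<subseteq> X"
    proof
      fix x assume x: "x \<in> {- e..0}"
      then have "exp (- e) \<le> exp x" by simp
      then show "x \<in> X" using less_le_trans[OF e(2)] x by (simp add: X_def)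
    qed
    define J where "J = (\<lambda>x. \<i> * integral (cbox (- pi) pi) (h x))"
    have "continuous_on {- e..0} J"
      unfolding J_def using X I by (intro continuous_intros) (rule continuous_on_subset)
    then have "(J \<longlongrightarrow> J 0) (at_left 0)"
      using e(1) by (intro continuous_on_Icc_at_leftD) auto
    moreover have "\<forall>\<^sub>F x in at_left 0. x \<in> {- e<..<0}"
      using e(1) by (intro eventually_at_left_real) auto
    then have "\<forall>\<^sub>F x in at_left 0. J x = p"
    proof eventually_elim
      case (elim x)
      then have "x \<in> X" "exp x < 1" using X by auto
      then have "am < exp x" "exp x < ap" using less_le_trans[OF _ assms(3)] by (simp_all add: X_def)
      then show ?case unfolding J_def by (rule int_h)
    qed
    then have "(J \<longlongrightarrow> p) (at_left 0)" by (rule tendsto_eventually)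
    ultimately have "J 0 = p" by (intro tendsto_unique[of "at_left 0"]) auto
    then show ?thesis by (simp add: J_def)
  qed
  moreover have "integral (cbox (- pi) pi) (h 0) = 2 * of_real pi * u (int n)"
  proof -
    have "h 0 t = Z_transform u (- exp (\<i> * of_real t)) * (- exp (\<i> * of_real t)) powi (- int n)" for t
      using f by (simp add: h_def G_def continues_Z_transform_def power_int_minus divide_inverse)
    then have "h 0 = (\<lambda>t. Z_transform u (- exp (\<i> * of_real t)) * (- exp (\<i> * of_real t)) powi (- int n))"
      by blast
    then show ?thesis
      using integral_unique[OF Z_transform_coefficient[OF l1, of "int n"]] by simp
  qed
  moreover have "P \<zeta> = p" using \<zeta> p by (simp add: T_def)
  ultimately show ?thesis by (simp add: P_def mult_ac)
qed

section \<open>Decay along the curve and its lift\<close>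

lemma integrable_exp_neg_abs:
  assumes "0 < \<delta>"
  shows "integrable lborel (\<lambda>y::real. exp (- \<delta> * \<bar>y\<bar>))"
proof -
  define h where "h = (\<lambda>y::real. indicator {0..} y * exp (- \<delta> * y))"
  have "integral\<^sup>N lborel h = ennreal (exp (- \<delta> * 0) / \<delta>)"
  proof (rule nn_integral_has_integral_lborel)
    have "h = (\<lambda>y. if y \<in> {0..} then exp (- \<delta> * y) else 0)" by (auto simp: h_def)
    then show "(h has_integral exp (- \<delta> * 0) / \<delta>) UNIV"
      using has_integral_exp_minus_to_infinity[OF assms, of 0] by (simp only: has_integral_restrict_UNIV)
  qed (auto simp: h_def)
  then have h: "integrable lborel h"
    by (intro integrableI_nonneg) (auto simp: h_def)
  then have "integrable lborel (\<lambda>y. h (0 + (- 1) * y))"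
    by (subst lborel_integrable_real_affine_iff) auto
  then have "integrable lborel (\<lambda>y. h y + h (- y))" using h by simp
  then show ?thesis
    by (rule Bochner_Integration.integrable_bound) (auto simp: h_def indicator_def)
qed

lemma integrable_if_exp_decay:
  fixes g :: "real \<Rightarrow> complex"
  assumes cont: "continuous_on UNIV g" and \<delta>: "0 < \<delta>"
    and decay: "\<And>y. Y \<le> \<bar>y\<bar> \<Longrightarrow> norm (g y) \<le> M * exp (- \<delta> * \<bar>y\<bar>)"
  shows "integrable lborel g"
proof -
  have "compact (g ` {- \<bar>Y\<bar>..\<bar>Y\<bar>})"
    by (intro compact_continuous_image continuous_on_subset[OF cont]) auto
  then have "bounded (g ` {- \<bar>Y\<bar>..\<bar>Y\<bar>})" by (rule compact_imp_bounded)
  then obtain B where B: "\<And>y. \<bar>y\<bar> \<le> \<bar>Y\<bar> \<Longrightarrow> norm (g y) \<le> B"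
    unfolding bounded_iff by (metis abs_le_D1 abs_le_D2 atLeastAtMost_iff imageI minus_le_iff)
  define M' where "M' = max M (B * exp (\<delta> * \<bar>Y\<bar>))"
  have "0 \<le> B" using B[of 0] norm_ge_zero[of "g 0"] by linarith
  have bound: "norm (g y) \<le> norm (M' * exp (- \<delta> * \<bar>y\<bar>))" for y
  proof -
    have "norm (g y) \<le> M' * exp (- \<delta> * \<bar>y\<bar>)"
    proof (cases "Y \<le> \<bar>y\<bar>")
      case True
      then show ?thesis
        by (rule order_trans[OF decay mult_right_mono]) (simp_all add: M'_def)
    next
      case False
      have "1 \<le> exp (\<delta> * \<bar>Y\<bar>) * exp (- \<delta> * \<bar>y\<bar>)"
      proof -
        have "\<delta> * \<bar>y\<bar> \<le> \<delta> * \<bar>Y\<bar>" using False \<delta> by (intro mult_left_mono) auto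
        then show ?thesis by (simp add: mult_exp_exp)
      qed
      then have "B * 1 \<le> B * (exp (\<delta> * \<bar>Y\<bar>) * exp (- \<delta> * \<bar>y\<bar>))"
        using \<open>0 \<le> B\<close> by (rule mult_left_mono)
      moreover have "norm (g y) \<le> B * 1" using False B[of y] by auto
      ultimately have "norm (g y) \<le> B * (exp (\<delta> * \<bar>Y\<bar>) * exp (- \<delta> * \<bar>y\<bar>))" by linarith
      also have "\<dots> \<le> M' * exp (- \<delta> * \<bar>y\<bar>)"
        unfolding mult.assoc[symmetric] by (intro mult_right_mono) (auto simp: M'_def)
      finally show ?thesis .
    qed
    then show ?thesis unfolding real_norm_def by (rule order_trans[OF _ abs_ge_self])
  qed
  have "g \<in> borel_measurable lborel"
    using borel_measurable_continuous_onI[OF cont] by simp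
  moreover have "integrable lborel (\<lambda>y. M' * exp (- \<delta> * \<bar>y\<bar>))"
    by (rule integrable_mult_right[OF integrable_exp_neg_abs[OF \<delta>]])
  moreover have "AE y in lborel. norm (g y) \<le> norm (M' * exp (- \<delta> * \<bar>y\<bar>))"
    using bound by (rule AE_I2)
  ultimately show ?thesis by (intro Bochner_Integration.integrable_bound[of lborel _ g])
qed

text \<open>For \<open>\<bar>z\<bar> \<ge> 1\<close> the factor \<open>(1 + \<bar>z\<bar>)\<^bsup>m\<^esup>\<close> may be replaced by \<open>2\<^bsup>\<bar>m\<bar>\<^esup> \<bar>z\<bar>\<^bsup>m\<^esup>\<close>, for either sign of \<open>m\<close>.\<close>
lemma Z_SINH1_decay:
  assumes "Z_SINH1 u f m am ap \<alpha>" "am < rm" "rm < rp" "rp < ap" "0 < \<alpha>1" "\<alpha>1 < \<alpha>"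
  obtains K where "0 \<le> K" "\<And>z. z \<in> U_dom rm rp \<alpha>1 \<Longrightarrow> 1 \<le> norm z \<Longrightarrow>
    norm (f z / z ^ n) \<le> K * norm z powr (m - real n)"
proof -
  obtain C where C: "\<And>z. z \<in> U_dom rm rp \<alpha>1 \<Longrightarrow> norm (f z) \<le> C * (1 + norm z) powr m"
    using assms unfolding Z_SINH1_def by metis
  have powr_le: "(1 + x) powr m \<le> 2 powr \<bar>m\<bar> * x powr m" if "1 \<le> x" for x
  proof (cases "0 \<le> m")
    case True
    then have "(1 + x) powr m \<le> (2 * x) powr m" using that by (intro powr_mono2) auto
    then show ?thesis using True that by (simp add: powr_mult)
  next
    case False
    then have "(1 + x) powr m \<le> 1 * x powr m" using that by (simp add: powr_mono2')
    also have "\<dots> \<le> 2 powr \<bar>m\<bar> * x powr m"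
      by (intro mult_right_mono ge_one_powr_ge_zero) auto
    finally show ?thesis .
  qed
  have "norm (f z / z ^ n) \<le> (\<bar>C\<bar> * 2 powr \<bar>m\<bar>) * norm z powr (m - real n)"
    if z: "z \<in> U_dom rm rp \<alpha>1" "1 \<le> norm z" for z
  proof -
    have "norm (f z) \<le> \<bar>C\<bar> * (1 + norm z) powr m"
      using C[OF z(1)] mult_right_mono[OF abs_ge_self[of C], of "(1 + norm z) powr m"] by simp
    also have "\<dots> \<le> \<bar>C\<bar> * (2 powr \<bar>m\<bar> * norm z powr m)"
      using powr_le[OF z(2)] by (intro mult_left_mono) auto
    finally have "norm (f z) / norm z ^ n \<le> \<bar>C\<bar> * (2 powr \<bar>m\<bar> * norm z powr m) / norm z ^ n"
      by (rule divide_right_mono) simp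
    also have "\<dots> = \<bar>C\<bar> * 2 powr \<bar>m\<bar> * norm z powr (m - real n)"
      using z(2) by (subst powr_diff, subst powr_realpow) auto
    finally show ?thesis by (simp add: norm_divide norm_power)
  qed
  then show ?thesis using that[of "\<bar>C\<bar> * 2 powr \<bar>m\<bar>"] by simp
qed

lemma sinh_path_has_vector_derivative:
  "(sinh_path \<sigma> b \<omega> has_vector_derivative \<i> * of_real b * cosh (\<i> * of_real \<omega> + of_real y)) (at y)"
  unfolding sinh_path_def[abs_def] chi_def
  by (rule has_vector_derivative_real_field) (auto intro!: derivative_eq_intros)

lemma norm_deriv_sinh_path_le:
  assumes "0 < b"
  shows "norm (\<i> * of_real b * cosh (\<i> * of_real \<omega> + of_real y)) \<le> b * exp \<bar>y\<bar>"
proof -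
  have "norm (cosh (\<i> * of_real \<omega> + complex_of_real y)) \<le> (exp y + exp (- y)) / 2"
    using norm_triangle_ineq[of "exp (\<i> * of_real \<omega> + complex_of_real y)"
      "exp (- (\<i> * of_real \<omega> + complex_of_real y))"]
    by (simp add: cosh_field_def norm_divide norm_exp_eq_Re)
  also have "\<dots> \<le> exp \<bar>y\<bar>" by (cases "0 \<le> y") auto
  finally show ?thesis using assms by (simp add: norm_mult)
qed

text \<open>Already the imaginary part grows exponentially. The bound \<open>\<bar>y\<bar> \<ge> 2\<close> ensures \<open>exp \<bar>y\<bar> \<ge> 2\<close>, so
that \<open>\<bar>sinh y\<bar> \<ge> exp \<bar>y\<bar> / 4\<close>.\<close>
lemma norm_sinh_path_growth:
  assumes "0 < b" "0 < cos \<omega>" "2 \<le> \<bar>y\<bar>"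
  shows "b * cos \<omega> / 4 * exp \<bar>y\<bar> \<le> norm (sinh_path \<sigma> b \<omega> y)"
proof -
  have le_exp: "2 \<le> exp \<bar>y\<bar>" using assms exp_ge_add_one_self[of "\<bar>y\<bar>"] by linarith
  have "exp \<bar>y\<bar> / 4 \<le> (exp \<bar>y\<bar> - exp (- \<bar>y\<bar>)) / 2"
    using le_exp order_trans[of "2 * exp (- \<bar>y\<bar>)" 2 "exp \<bar>y\<bar>"] by (simp add: diff_divide_distrib)
  also have "\<dots> = \<bar>sinh y\<bar>" by (cases "0 \<le> y") (auto simp: sinh_field_def)
  finally have "exp \<bar>y\<bar> / 4 \<le> \<bar>sinh y\<bar>" .
  then have "b * cos \<omega> * (exp \<bar>y\<bar> / 4) \<le> b * cos \<omega> * \<bar>sinh y\<bar>"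
    using assms by (intro mult_left_mono) auto
  also have "\<dots> = \<bar>Im (sinh_path \<sigma> b \<omega> y)\<bar>" using assms by (simp add: sinh_path_Re_Im abs_mult)
  also have "\<dots> \<le> norm (sinh_path \<sigma> b \<omega> y)" by (rule abs_Im_le_cmod)
  finally show ?thesis by simp
qed

text \<open>The growth bound is assumed on strictly smaller domains only, but these can be chosen to
contain the tails of the curve: the angle condition \<open>\<omega> > \<pi>/2 - \<alpha>\<close> and the position of the vertex
leave room.\<close>
lemma ex_tail_domain:
  assumes "0 < \<alpha>" "\<alpha> < pi" "pi/2 - \<alpha> < \<omega>" "\<omega> < pi/2" "0 < b" "\<sigma> * sin \<omega> < b"
    "am < \<sigma> - b * sin \<omega>" "\<sigma> - b * sin \<omega> < ap"
  obtains rm rp \<alpha>1 Y where "am < rm" "rm < rp" "rp < ap" "0 < \<alpha>1" "\<alpha>1 < \<alpha>"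
    "\<And>y. Y \<le> \<bar>y\<bar> \<Longrightarrow> sinh_path \<sigma> b \<omega> y \<in> U_dom rm rp \<alpha>1"
proof -
  define x0 rm rp \<alpha>1 where "x0 = \<sigma> - b * sin \<omega>" and "rm = (am + x0) / 2" and "rp = (x0 + ap) / 2"
    and "\<alpha>1 = (max 0 (pi/2 - \<omega>) + \<alpha>) / 2"
  have r: "am < rm" "rm < x0" "x0 < rp" "rp < ap" using assms by (auto simp: rm_def rp_def x0_def)
  have \<alpha>1: "0 < \<alpha>1" "\<alpha>1 < \<alpha>" "pi/2 - \<alpha>1 < \<omega>" using assms by (auto simp: \<alpha>1_def max_def field_simps)
  define \<kappa> where "\<kappa> = - cos (\<alpha>1 + \<omega>)"
  have \<kappa>: "0 < \<kappa>" using cos_add_neg[of \<alpha>1 \<omega>] \<alpha>1 assms by (simp add: \<kappa>_def)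
  define Y where "Y = 2 * (b + \<bar>rp - \<sigma>\<bar>) / (b * \<kappa>)"
  have "sinh_path \<sigma> b \<omega> y \<in> U_dom rm rp \<alpha>1" if y: "Y \<le> \<bar>y\<bar>" for y
  proof (rule sinh_path_tail_in_U_dom)
    have "Y < exp \<bar>y\<bar>" using y exp_ge_add_one_self[of "\<bar>y\<bar>"] by linarith
    then have "2 * (b + \<bar>rp - \<sigma>\<bar>) < b * \<kappa> * exp \<bar>y\<bar>"
      using assms \<kappa> by (simp add: Y_def field_simps)
    also have "\<dots> \<le> b * \<kappa> * (2 * cosh y)"
      using assms \<kappa> exp_abs_le_cosh[of y] by (intro mult_left_mono) auto
    finally show "b + \<bar>rp - \<sigma>\<bar> < b * (- cos (\<alpha>1 + \<omega>)) * cosh y" by (simp add: \<kappa>_def)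
    show "rm < norm (sinh_path \<sigma> b \<omega> y)"
      using norm_sinh_path_ge[of b \<sigma> \<omega> y] assms r by (simp add: x0_def)
  qed (use \<alpha>1 assms in auto)
  then show ?thesis using that[of rm rp \<alpha>1 Y] r \<alpha>1 by auto
qed

text \<open>The shift \<open>c\<close> is \<open>\<plusminus> \<pi> i\<close> in the applications. It turns \<open>Ln\<close> into a right inverse of
\<open>\<zeta> \<mapsto> - exp \<zeta>\<close>, whose image of the curve is in the domain \<open>V\<close> of the primitive.\<close>
lemma integral_via_log:
  assumes \<gamma>: "\<And>y. y \<in> {p..q} \<Longrightarrow> (\<gamma> has_vector_derivative \<gamma>' y) (at y)"
    and slit: "\<And>y. y \<in> {p..q} \<Longrightarrow> \<gamma> y \<notin> \<real>\<^sub>\<le>\<^sub>0"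
    and mem: "\<And>y. y \<in> {p..q} \<Longrightarrow> Ln (\<gamma> y) + c \<in> V"
    and \<Phi>: "\<And>\<zeta>. \<zeta> \<in> V \<Longrightarrow> (\<Phi> has_field_derivative F (- exp \<zeta>)) (at \<zeta>)"
    and c: "exp c = -1" and "p \<le> q"
  shows "((\<lambda>y. F (\<gamma> y) / \<gamma> y * \<gamma>' y) has_integral
    \<Phi> (Ln (\<gamma> q) + c) - \<Phi> (Ln (\<gamma> p) + c)) {p..q}"
proof (rule fundamental_theorem_of_calculus)
  fix y assume y: "y \<in> {p..q}"
  have nz: "\<gamma> y \<noteq> 0" using slit[OF y] by auto
  have "((\<lambda>z. Ln z + c) has_field_derivative inverse (\<gamma> y)) (at (\<gamma> y))"
    using slit[OF y] by (auto intro!: derivative_eq_intros)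
  then have "((\<lambda>z. \<Phi> (Ln z + c)) has_field_derivative F (- exp (Ln (\<gamma> y) + c)) * inverse (\<gamma> y))
      (at (\<gamma> y))"
    by (rule DERIV_chain2[where f = \<Phi> and g = "\<lambda>z. Ln z + c", OF \<Phi>[OF mem[OF y]]])
  then have "((\<lambda>z. \<Phi> (Ln z + c)) has_field_derivative F (\<gamma> y) / \<gamma> y) (at (\<gamma> y))"
    using nz c by (simp add: exp_add divide_inverse)
  from field_vector_diff_chain_at[OF \<gamma>[OF y] this]
  show "((\<lambda>y. \<Phi> (Ln (\<gamma> y) + c)) has_vector_derivative F (\<gamma> y) / \<gamma> y * \<gamma>' y) (at y within {p..q})"
    by (auto simp: o_def mult.commute intro: has_vector_derivative_at_within)
qed (use assms in auto)

lemma tendsto_integral_symmetric_intervals: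
  fixes g :: "real \<Rightarrow> complex"
  assumes g: "integrable lborel g"
  shows "(\<lambda>k. integral {- real k..real k} g) \<longlonglongrightarrow> (LINT y|lborel. g y)"
proof -
  have "integral {- real k..real k} g = (LINT y|lborel. indicator {- real k..real k} y *\<^sub>R g y)" for k
    using set_borel_integral_eq_integral(2)[of "{- real k..real k}" g] integrable_mult_indicator[OF _ g]
    by (simp add: set_integrable_def set_lebesgue_integral_def)
  moreover have "(\<lambda>k. LINT y|lborel. indicator {- real k..real k} y *\<^sub>R g y) \<longlonglongrightarrow> (LINT y|lborel. g y)"
  proof (rule integral_dominated_convergence)
    show "integrable lborel (\<lambda>y. norm (g y))" using g by simp
    show "AE y in lborel. (\<lambda>k. indicator {- real k..real k} y *\<^sub>R g y) \<longlonglongrightarrow> g y"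
    proof (intro AE_I2 tendsto_eventually)
      fix y :: real
      obtain N where "\<bar>y\<bar> \<le> real N" using real_arch_simple by blast
      then show "\<forall>\<^sub>F k in sequentially. indicator {- real k..real k} y *\<^sub>R g y = g y"
        by (intro eventually_sequentiallyI[of N]) (auto simp: indicator_def)
    qed
    show "AE y in lborel. norm (indicator {- real k..real k} y *\<^sub>R g y) \<le> norm (g y)" for k
      by (auto simp: indicator_def)
  qed (use borel_measurable_integrable[OF g] in auto)
  ultimately show ?thesis by simp
qed

lemma sinh_path_not_nonpos_Reals:
  assumes "0 < b" "0 < cos \<omega>" "0 < \<sigma> - b * sin \<omega>"
  shows "sinh_path \<sigma> b \<omega> y \<notin> \<real>\<^sub>\<le>\<^sub>0"
  using assms by (cases "y = 0") (auto simp: complex_nonpos_Reals_iff sinh_path_Re_Im)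

text \<open>The lower half of the curve is lifted with \<open>s = 1\<close>, the upper half with \<open>s = - 1\<close>. The vertex is
the only point of the curve that is lifted to \<open>\<bar>Im \<zeta>\<bar> = \<pi>\<close>. It belongs to \<open>log_dom\<close> since it lies in
the annulus.\<close>
lemma log_sinh_path_in_log_dom:
  assumes "0 < \<alpha>" "\<alpha> < pi" "0 \<le> am" "0 < b" "0 < cos \<omega>"
    and "am < \<sigma> - b * sin \<omega>" "\<sigma> - b * sin \<omega> < ap"
    and inside: "sinh_path \<sigma> b \<omega> y \<in> U_dom am ap \<alpha>"
    and s: "s = 1 \<and> y \<le> 0 \<or> s = - 1 \<and> 0 \<le> y"
  shows "Ln (sinh_path \<sigma> b \<omega> y) + of_real (s * pi) * \<i> \<in> log_dom am ap \<alpha>"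
proof (cases "y = 0")
  case True
  have "exp (Re (Ln (complex_of_real (\<sigma> - b * sin \<omega>)))) = \<sigma> - b * sin \<omega>"
    using assms by (subst Ln_of_real) auto
  then show ?thesis
    using assms True by (simp add: log_dom_def sinh_path_0)
next
  case False
  define z where "z = sinh_path \<sigma> b \<omega> y"
  have "z \<noteq> 0"
    using sinh_path_not_nonpos_Reals[of b \<omega> \<sigma> y] assms by (auto simp: z_def)
  have im: "0 < Im z \<longleftrightarrow> 0 < y"
    using assms(4,5) by (auto simp: z_def sinh_path_Re_Im zero_less_mult_iff mult_less_0_iff)
  have ne: "Im z \<noteq> 0" using assms False by (simp add: z_def sinh_path_Re_Im)
  have "\<bar>Im (Ln z) + s * pi\<bar> < pi"
    using s False im ne Im_Ln_pos_lt[OF \<open>z \<noteq> 0\<close>] Im_Ln_pos_le[OF \<open>z \<noteq> 0\<close>]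
      mpi_less_Im_Ln[OF \<open>z \<noteq> 0\<close>] Im_Ln_le_pi[OF \<open>z \<noteq> 0\<close>] by auto
  moreover have "- exp (Ln z + of_real (s * pi) * \<i>) = z"
    using s \<open>z \<noteq> 0\<close> by (auto simp: exp_add exp_minus)
  ultimately show ?thesis
    using assms by (intro log_domI) (auto simp: z_def)
qed

section \<open>The coefficient formula\<close>

text \<open>The two lifts of the curve meet the primitive \<open>\<Phi>\<close> in four end points. Those of the vertex
differ by a period of \<open>\<Phi>\<close>, and those at parameters \<open>\<plusminus>k\<close> by the integral over an arc that tends to
\<open>0\<close> as \<open>k\<close> grows.\<close>
lemma coefficient_formula_sinh_path:
  assumes l1: "(\<lambda>k. norm (u k)) summable_on UNIV"
    and sinh1: "Z_SINH1 u f m am ap \<alpha>"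
    and n: "m < real n"
    and \<omega>: "pi/2 - \<alpha> < \<omega>" "\<omega> < pi/2" and b: "0 < b" "\<sigma> * sin \<omega> < b"
    and vertex: "am < \<sigma> - b * sin \<omega>" "\<sigma> - b * sin \<omega> < ap"
    and inside: "sinh_curve \<sigma> b \<omega> \<subseteq> U_dom am ap \<alpha>"
  shows "coefficient_formula u f n \<sigma> b \<omega>"
proof -
  have \<alpha>: "0 < \<alpha>" "\<alpha> < pi" and am: "0 \<le> am" "am < 1" "1 \<le> ap"
    and cont: "continues_Z_transform f u am ap \<alpha>"
    using sinh1 by (auto simp: Z_SINH1_def)
  then have hol: "f holomorphic_on U_dom am ap \<alpha>" by (simp add: continues_Z_transform_def)
  have c: "0 < cos \<omega>" using \<alpha> \<omega> by (intro cos_gt_zero_pi) auto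
  define \<gamma> where "\<gamma> = sinh_path \<sigma> b \<omega>"
  define \<gamma>' where "\<gamma>' = (\<lambda>y::real. \<i> * of_real b * cosh (\<i> * of_real \<omega> + of_real y) :: complex)"
  have deriv: "(\<gamma> has_vector_derivative \<gamma>' y) (at y)" for y
    unfolding \<gamma>_def \<gamma>'_def by (rule sinh_path_has_vector_derivative)
  have in_U: "\<gamma> y \<in> U_dom am ap \<alpha>" for y using inside by (auto simp: \<gamma>_def sinh_curve_def)
  have slit: "\<gamma> y \<notin> \<real>\<^sub>\<le>\<^sub>0" for y
    unfolding \<gamma>_def using b c vertex am by (intro sinh_path_not_nonpos_Reals) auto
  have nz: "\<gamma> y \<noteq> 0" for y using slit[of y] by auto
  define F where "F = (\<lambda>z. f z / z ^ n)"
  define g where "g = (\<lambda>y. F (\<gamma> y) / \<gamma> y * \<gamma>' y)"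
  have g_eq: "line_integrand (sinh_path \<sigma> b \<omega>) (\<lambda>z. f z * z powi (- int n - 1)) = g"
  proof
    fix y
    have "vector_derivative \<gamma> (at y) = \<gamma>' y" using deriv by (rule vector_derivative_at)
    moreover have "\<gamma> y powi (- int n - 1) = inverse (\<gamma> y ^ n) / \<gamma> y"
      using nz[of y] by (simp add: power_int_diff power_int_minus)
    ultimately show "line_integrand (sinh_path \<sigma> b \<omega>) (\<lambda>z. f z * z powi (- int n - 1)) y = g y"
      by (simp add: line_integrand_def g_def F_def divide_inverse flip: \<gamma>_def)
  qed

  obtain \<Phi> where \<Phi>: "\<And>\<zeta>. \<zeta> \<in> log_dom am ap \<alpha> \<Longrightarrow>
      (\<Phi> has_field_derivative F (- exp \<zeta>)) (at \<zeta>)"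
    unfolding F_def using ex_log_dom_primitive[OF \<alpha> am(1) _ hol] am by (metis less_le_trans)
  \<comment> \<open>The lift of the curve to logarithmic coordinates, with \<open>s = 1\<close> for \<open>y \<le> 0\<close> and \<open>s = - 1\<close> for
  \<open>y \<ge> 0\<close>.\<close>
  define L where "L = (\<lambda>s y. Ln (\<gamma> y) + of_real (s * pi) * \<i>)"
  have L_mem: "L s y \<in> log_dom am ap \<alpha>" if "s = 1 \<and> y \<le> 0 \<or> s = - 1 \<and> 0 \<le> y" for s y
    unfolding L_def \<gamma>_def using \<alpha> am b c vertex in_U[of y] that
    by (intro log_sinh_path_in_log_dom) (auto simp: \<gamma>_def)
  have exp_pi: "exp (of_real (s * pi) * \<i>) = - 1" if "s = 1 \<or> s = - 1" for s
    using that by (auto simp: exp_minus)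
  have L_exp: "- exp (L s y) = \<gamma> y" "Re (L s y) = ln (norm (\<gamma> y))" if "s = 1 \<or> s = - 1" for s y
    using exp_pi[OF that] nz[of y] by (auto simp: L_def exp_add)
  have half: "(g has_integral \<Phi> (L s q) - \<Phi> (L s p)) {p..q}"
    if pq: "s = 1 \<and> q \<le> 0 \<or> s = - 1 \<and> 0 \<le> p" "p \<le> q" for s p q
    unfolding g_def L_def
  proof (rule integral_via_log[where V = "log_dom am ap \<alpha>"])
    fix y assume "y \<in> {p..q}"
    then have "s = 1 \<and> y \<le> 0 \<or> s = - 1 \<and> 0 \<le> y" using pq by auto
    from L_mem[OF this] show "Ln (\<gamma> y) + of_real (s * pi) * \<i> \<in> log_dom am ap \<alpha>"
      by (simp only: L_def)
  next
    show "exp (of_real (s * pi) * \<i>) = - 1" using pq by (intro exp_pi) auto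
  qed (use deriv slit \<Phi> pq in auto)
  have period: "\<Phi> (L 1 0) - \<Phi> (L (- 1) 0) = 2 * of_real pi * \<i> * u (int n)"
  proof -
    have "exp (Re (Ln (\<gamma> 0))) = norm (\<gamma> 0)" using nz[of 0] by simp
    then have "am < exp (Re (Ln (\<gamma> 0)))" "exp (Re (Ln (\<gamma> 0))) < ap"
      using vertex am by (simp_all add: \<gamma>_def sinh_path_0 flip: of_real_mult of_real_diff)
    from primitive_period[OF am l1 cont \<Phi>[unfolded F_def] this]
    show ?thesis by (simp add: L_def mult.commute)
  qed
  have symm: "integral {- real k..real k} g = 2 * of_real pi * \<i> * u (int n)
      - (\<Phi> (L 1 (- real k)) - \<Phi> (L (- 1) (real k)))" for k
  proof -
    have "(g has_integral (\<Phi> (L 1 0) - \<Phi> (L 1 (- real k))) + (\<Phi> (L (- 1) (real k)) - \<Phi> (L (- 1) 0)))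
        {- real k..real k}"
      by (rule has_integral_combine[of _ 0]) (use half in auto)
    then show ?thesis using period by (simp add: integral_unique)
  qed

  obtain rm rp \<alpha>1 Y where r: "am < rm" "rm < rp" "rp < ap" and \<alpha>1: "0 < \<alpha>1" "\<alpha>1 < \<alpha>"
    and tail: "\<And>y. Y \<le> \<bar>y\<bar> \<Longrightarrow> \<gamma> y \<in> U_dom rm rp \<alpha>1"
    using ex_tail_domain[OF \<alpha> \<omega> b vertex] unfolding \<gamma>_def by metis
  obtain K where K: "0 \<le> K" and F_le: "\<And>z. z \<in> U_dom rm rp \<alpha>1 \<Longrightarrow> 1 \<le> norm z \<Longrightarrow>
      norm (F z) \<le> K * norm z powr (m - real n)"
    unfolding F_def using Z_SINH1_decay[OF sinh1 r \<alpha>1] by metis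
  define \<kappa> where "\<kappa> = b * cos \<omega> / 4"
  have \<kappa>: "0 < \<kappa>" using b c by (simp add: \<kappa>_def)
  \<comment> \<open>Beyond \<open>Y'\<close> the curve lies in the domain of the growth bound, grows exponentially and has norm at least
  \<open>1\<close>.\<close>
  define Y' where "Y' = Max {2, 1 / \<kappa>, Y}"
  have Y': "2 \<le> Y'" "1 / \<kappa> \<le> Y'" "Y \<le> Y'" by (auto simp: Y'_def)
  have growth: "\<kappa> * exp \<bar>y\<bar> \<le> norm (\<gamma> y)" "1 \<le> norm (\<gamma> y)" if y: "Y' \<le> \<bar>y\<bar>" for y
  proof -
    show *: "\<kappa> * exp \<bar>y\<bar> \<le> norm (\<gamma> y)"
      unfolding \<kappa>_def \<gamma>_def using b c y Y' by (intro norm_sinh_path_growth) auto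
    have "1 / \<kappa> \<le> exp \<bar>y\<bar>" using y Y' exp_ge_add_one_self[of "\<bar>y\<bar>"] by linarith
    then have "1 \<le> \<kappa> * exp \<bar>y\<bar>" using \<kappa> by (simp add: field_simps)
    then show "1 \<le> norm (\<gamma> y)" using * by linarith
  qed
  define \<delta> where "\<delta> = real n - m"
  have \<delta>: "0 < \<delta>" using n by (simp add: \<delta>_def)
  have powr_le: "norm (\<gamma> y) powr (m - real n) \<le> \<kappa> powr (- \<delta>) * exp (- \<delta> * \<bar>y\<bar>)"
    if y: "Y' \<le> \<bar>y\<bar>" for y
  proof -
    have "norm (\<gamma> y) powr (m - real n) \<le> (\<kappa> * exp \<bar>y\<bar>) powr (m - real n)"
      using growth[OF y] \<kappa> n by (intro powr_mono2') auto
    also have "\<dots> = \<kappa> powr (- \<delta>) * exp (- \<delta> * \<bar>y\<bar>)"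
      using \<kappa> by (simp add: powr_mult \<delta>_def exp_powr_real mult.commute)
    finally show ?thesis .
  qed

  have "integrable lborel g"
  proof (rule integrable_if_exp_decay[OF _ \<delta>])
    have "continuous_on UNIV \<gamma>"
      using deriv by (intro continuous_at_imp_continuous_on) (auto intro: has_vector_derivative_continuous)
    then show "continuous_on UNIV g"
      unfolding g_def F_def \<gamma>'_def cosh_field_def
      by (intro continuous_intros continuous_on_compose2[OF holomorphic_on_imp_continuous_on[OF hol]])
        (use nz in_U in auto)
    show "norm (g y) \<le> (K * \<kappa> powr (- \<delta>) * (b / \<kappa>)) * exp (- \<delta> * \<bar>y\<bar>)" if y: "Y' \<le> \<bar>y\<bar>" for y
    proof -
      have "norm (F (\<gamma> y)) \<le> K * norm (\<gamma> y) powr (m - real n)"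
        using F_le tail growth y Y' by auto
      also have "\<dots> \<le> K * (\<kappa> powr (- \<delta>) * exp (- \<delta> * \<bar>y\<bar>))"
        using powr_le[OF y] K by (rule mult_left_mono)
      finally have 1: "norm (F (\<gamma> y)) \<le> K * (\<kappa> powr (- \<delta>) * exp (- \<delta> * \<bar>y\<bar>))" .
      have "norm (\<gamma>' y) / norm (\<gamma> y) \<le> (b * exp \<bar>y\<bar>) / (\<kappa> * exp \<bar>y\<bar>)"
        using growth[OF y] \<kappa> b norm_deriv_sinh_path_le[of b \<omega> y]
        by (intro frac_le) (auto simp: \<gamma>'_def)
      then have 2: "norm (\<gamma>' y) / norm (\<gamma> y) \<le> b / \<kappa>" by simp
      have "norm (g y) = norm (F (\<gamma> y)) * (norm (\<gamma>' y) / norm (\<gamma> y))"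
        by (simp add: g_def norm_mult norm_divide)
      also have "\<dots> \<le> K * (\<kappa> powr (- \<delta>) * exp (- \<delta> * \<bar>y\<bar>)) * (b / \<kappa>)"
        using 1 2 K by (intro mult_mono) auto
      finally show ?thesis by (simp add: mult_ac)
    qed
  qed

  have arc: "norm (\<Phi> (L 1 (- real k)) - \<Phi> (L (- 1) (real k)))
      \<le> K * (\<kappa> powr (- \<delta>) * exp (- \<delta> * real k)) * (2 * pi)" if k: "Y' \<le> real k" for k
  proof -
    \<comment> \<open>Lifting the arc from \<open>z(k)\<close> to \<open>z(-k)\<close> across the negative axis gives the vertical segment from
    \<open>\<zeta>\<close> to its conjugate, on which the derivative of \<open>\<Phi>\<close> is bounded by the growth condition.\<close>
    define \<zeta> where "\<zeta> = L (- 1) (real k)"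
    have k0: "0 < real k" using k Y' by linarith
    have cnj_\<gamma>: "\<gamma> (- real k) = cnj (\<gamma> (real k))" by (simp add: \<gamma>_def complex_eq_iff sinh_path_Re_Im)
    have \<zeta>_cnj: "L 1 (- real k) = cnj \<zeta>"
      using slit[of "real k"] by (simp add: \<zeta>_def L_def cnj_\<gamma> cnj_Ln)
    have \<zeta>: "- exp \<zeta> = \<gamma> (real k)" "exp (Re \<zeta>) = norm (\<gamma> (real k))"
      using L_exp[of "- 1" "real k"] nz[of "real k"] by (simp_all add: \<zeta>_def)
    have "Im (\<gamma> (real k)) > 0" using b c k0 by (simp add: \<gamma>_def sinh_path_Re_Im)
    then have im: "\<bar>Im \<zeta>\<bar> < pi"
      using Im_Ln_pos_lt[OF nz[of "real k"]] by (simp add: \<zeta>_def L_def)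
    have "norm (\<Phi> (cnj \<zeta>) - \<Phi> \<zeta>) \<le> K * (\<kappa> powr (- \<delta>) * exp (- \<delta> * real k)) * norm (cnj \<zeta> - \<zeta>)"
    proof (rule field_differentiable_bound[of "closed_segment \<zeta> (cnj \<zeta>)" \<Phi> "\<lambda>\<xi>. F (- exp \<xi>)"])
      fix \<xi> assume "\<xi> \<in> closed_segment \<zeta> (cnj \<zeta>)"
      then obtain t where t: "0 \<le> t" "t \<le> 1" "\<xi> = (1 - t) *\<^sub>R \<zeta> + t *\<^sub>R cnj \<zeta>"
        by (auto simp: closed_segment_def)
      have re: "Re \<xi> = Re \<zeta>" by (simp add: t(3) algebra_simps)
      have "Im \<xi> = (1 - 2 * t) * Im \<zeta>" by (simp add: t(3) algebra_simps)
      moreover have "\<bar>1 - 2 * t\<bar> \<le> 1" using t by linarith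
      ultimately have im_le: "\<bar>Im \<xi>\<bar> \<le> \<bar>Im \<zeta>\<bar>"
        by (simp add: abs_mult mult_left_le_one_le)
      have "- exp \<xi> \<in> U_dom am ap \<alpha>"
        using arc_subset_U_dom[OF \<alpha> _ _ _ re im_le, of ap am] am in_U \<zeta> im by auto
      then have "\<xi> \<in> log_dom am ap \<alpha>" using \<alpha> im im_le by (intro log_domI) auto
      then show "(\<Phi> has_field_derivative F (- exp \<xi>)) (at \<xi> within closed_segment \<zeta> (cnj \<zeta>))"
        using \<Phi> by (blast intro: has_field_derivative_at_within)
      have "- exp \<xi> \<in> U_dom rm rp \<alpha>1"
        using arc_subset_U_dom[OF \<alpha>1(1) _ _ _ _ re im_le, of rp rm] am r \<alpha>1 \<alpha> tail[of "real k"] k Y' \<zeta> im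
        by auto
      moreover have nrm: "norm (- exp \<xi>) = norm (\<gamma> (real k))"
        using \<zeta>(2) re by (simp add: norm_exp_eq_Re)
      ultimately have "norm (F (- exp \<xi>)) \<le> K * norm (\<gamma> (real k)) powr (m - real n)"
        using F_le[of "- exp \<xi>"] growth(2)[of "real k"] k by simp
      also have "\<dots> \<le> K * (\<kappa> powr (- \<delta>) * exp (- \<delta> * real k))"
        using powr_le[of "real k"] K k by (intro mult_left_mono) auto
      finally show "norm (F (- exp \<xi>)) \<le> K * (\<kappa> powr (- \<delta>) * exp (- \<delta> * real k))" .
    qed auto
    also have "norm (cnj \<zeta> - \<zeta>) \<le> 2 * pi"
      using im cmod_le[of "cnj \<zeta> - \<zeta>"] by simp
    finally show ?thesis using K unfolding \<zeta>_cnj \<zeta>_def by (simp add: mult_left_mono)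
  qed
  have "(\<lambda>k. \<Phi> (L 1 (- real k)) - \<Phi> (L (- 1) (real k))) \<longlonglongrightarrow> 0"
  proof (rule Lim_null_comparison)
    show "\<forall>\<^sub>F k in sequentially. norm (\<Phi> (L 1 (- real k)) - \<Phi> (L (- 1) (real k)))
        \<le> K * (\<kappa> powr (- \<delta>) * exp (- \<delta> * real k)) * (2 * pi)"
      using eventually_ge_at_top[of "nat \<lceil>Y'\<rceil>"] by eventually_elim (rule arc, linarith)
    have "(\<lambda>k. exp (- \<delta> * real k)) \<longlonglongrightarrow> 0"
      using \<delta> by real_asymp
    then show "(\<lambda>k. K * (\<kappa> powr (- \<delta>) * exp (- \<delta> * real k)) * (2 * pi)) \<longlonglongrightarrow> 0"
      by (intro tendsto_mult_left_zero tendsto_mult_right_zero)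
  qed
  then have "(\<lambda>k. integral {- real k..real k} g) \<longlonglongrightarrow> 2 * of_real pi * \<i> * u (int n)"
    unfolding symm using tendsto_diff[OF tendsto_const[of "2 * of_real pi * \<i> * u (int n)"]] by force
  with tendsto_integral_symmetric_intervals[OF \<open>integrable lborel g\<close>]
  have "(LINT y|lborel. g y) = 2 * of_real pi * \<i> * u (int n)"
    by (rule LIMSEQ_unique)
  then show ?thesis
    unfolding coefficient_formula_def Let_def g_eq
    using \<open>integrable lborel g\<close> by simp
qed

theorem theorem3p1:
  fixes u :: "int \<Rightarrow> complex" and f :: "complex \<Rightarrow> complex"
    and m am ap \<alpha> :: real and n :: nat
  assumes l1: "(\<lambda>k. norm (u k)) summable_on UNIV"
    and sinh1: "Z_SINH1 u f m am ap \<alpha>"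
    and n: "real n > m"
  shows
    "(\<forall>\<omega> \<in> {pi/2 - \<alpha> <..< pi/2}. \<exists>\<sigma>>0. \<exists>b>0.
        b > \<sigma> * sin \<omega> \<and> \<sigma> - b * sin \<omega> \<in> {am <..< ap}) \<and>
     (\<forall>\<sigma> b \<omega>. admissible am ap \<alpha> \<sigma> b \<omega> \<longrightarrow>
        infdist 0 (sinh_curve \<sigma> b \<omega>) = \<sigma> - b * sin \<omega> \<and>
        (inside_if_acute am ap \<alpha> \<sigma> b \<omega> \<longrightarrow>
           sinh_curve \<sigma> b \<omega> \<subseteq> U_dom am ap \<alpha> \<and>
           coefficient_formula u f n \<sigma> b \<omega>)) \<and>
     (pi/2 < \<alpha> \<longrightarrow>
        (\<forall>\<omega> \<in> {pi/2 - \<alpha> <.. 0}. \<forall>b>0.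
          \<forall>\<sigma> \<in> {am + b * sin \<omega> <..< ap + b * sin \<omega>}.
            sinh_curve \<sigma> b \<omega> \<subseteq> U_dom am ap \<alpha> \<and>
            coefficient_formula u f n \<sigma> b \<omega>)) \<and>
     (\<forall>\<sigma> b \<omega>.
        admissible am ap \<alpha> \<sigma> b \<omega> \<or>
        (pi/2 < \<alpha> \<and> \<omega> \<in> {pi/2 - \<alpha> <.. 0} \<and> b > 0 \<and>
         \<sigma> \<in> {am + b * sin \<omega> <..< ap + b * sin \<omega>}) \<longrightarrow>
        (\<exists>d>0.
           (inside_if_acute am ap \<alpha> \<sigma> b \<omega> \<longrightarrow>
              chi \<sigma> b \<omega> ` strip d \<subseteq> U_dom am ap \<alpha>) \<and>
           infdist 0 (chi \<sigma> b \<omega> ` strip d) = \<sigma> - b * sin (\<omega> + d)))"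
proof -
  have \<alpha>: "0 < \<alpha>" "\<alpha> < pi" and am: "0 \<le> am" "am < ap"
    using sinh1 by (auto simp: Z_SINH1_def)
  \<comment> \<open>The common hypothesis of both types of curves: apart from the inclusion for acute angles,
  it gives everything that is claimed about a single curve.\<close>
  define good where
    "good = (\<lambda>\<sigma> b \<omega>. pi/2 - \<alpha> < \<omega> \<and> \<omega> < pi/2 \<and> 0 < b \<and> \<sigma> * sin \<omega> < b \<and>
    am < \<sigma> - b * sin \<omega> \<and> \<sigma> - b * sin \<omega> < ap)"
  have good_if_admissible: "good \<sigma> b \<omega>" if "admissible am ap \<alpha> \<sigma> b \<omega>" for \<sigma> b \<omega>
    using that by (auto simp: good_def admissible_def)
  have good_if_nonpos: "good \<sigma> b \<omega>"
    if "\<omega> \<in> {pi/2 - \<alpha> <.. 0}" "0 < b" "\<sigma> \<in> {am + b * sin \<omega> <..< ap + b * sin \<omega>}" for \<sigma> b \<omega>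
    using that \<alpha> am sigma_sin_less[of b \<omega> \<sigma>] by (auto simp: good_def)
  have inside: "sinh_curve \<sigma> b \<omega> \<subseteq> U_dom am ap \<alpha>"
    if "good \<sigma> b \<omega>" "inside_if_acute am ap \<alpha> \<sigma> b \<omega>" for \<sigma> b \<omega>
    using that \<alpha> sinh_curve_subset_U_dom[of \<alpha> \<omega> b \<sigma> am ap]
    by (cases "\<alpha> < pi/2") (auto simp: good_def inside_if_acute_def)
  have formula: "coefficient_formula u f n \<sigma> b \<omega>"
    if "good \<sigma> b \<omega>" "sinh_curve \<sigma> b \<omega> \<subseteq> U_dom am ap \<alpha>" for \<sigma> b \<omega>
    using that by (intro coefficient_formula_sinh_path[OF l1 sinh1 n]) (auto simp: good_def)
  have strip_distance: "\<exists>d>0. (inside_if_acute am ap \<alpha> \<sigma> b \<omega> \<longrightarrow> chi \<sigma> b \<omega> ` strip d \<subseteq> U_dom am ap \<alpha>) \<and>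
      infdist 0 (chi \<sigma> b \<omega> ` strip d) = \<sigma> - b * sin (\<omega> + d)"
    if good: "good \<sigma> b \<omega>" for \<sigma> b \<omega>
  proof -
    obtain d1 where d1: "0 < d1" "\<And>d. 0 < d \<Longrightarrow> d < d1 \<Longrightarrow>
        infdist 0 (chi \<sigma> b \<omega> ` strip d) = \<sigma> - b * sin (\<omega> + d)"
      using ex_infdist_strip[of \<omega> b \<sigma>] good \<alpha> am by (auto simp: good_def)
    obtain d2 where d2: "0 < d2"
      "inside_if_acute am ap \<alpha> \<sigma> b \<omega> \<Longrightarrow> chi \<sigma> b \<omega> ` strip d2 \<subseteq> U_dom am ap \<alpha>"
    proof (cases "inside_if_acute am ap \<alpha> \<sigma> b \<omega>")
      case True
      then show ?thesis
        using that ex_strip_subset_U_dom[of \<alpha> \<omega> b \<sigma> am ap] inside[OF good] good \<alpha>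
        by (auto simp: good_def)
    qed (use that[of 1] in simp)
    define d where "d = min (d1 / 2) d2"
    have "0 < d" "d < d1" "strip d \<subseteq> strip d2" using d1(1) d2(1) by (auto simp: d_def strip_def)
    then show ?thesis using d1(2) d2(2) by blast
  qed
  show ?thesis
  proof (intro conjI allI ballI impI)
    fix \<omega> assume "\<omega> \<in> {pi/2 - \<alpha> <..< pi/2}"
    then show "\<exists>\<sigma>>0. \<exists>b>0. b > \<sigma> * sin \<omega> \<and> \<sigma> - b * sin \<omega> \<in> {am <..< ap}"
      using \<alpha> am by (intro ex_vertex) auto
  next
    fix \<sigma> b \<omega> assume "admissible am ap \<alpha> \<sigma> b \<omega>"
    then have good: "good \<sigma> b \<omega>" by (rule good_if_admissible)
    then show "infdist 0 (sinh_curve \<sigma> b \<omega>) = \<sigma> - b * sin \<omega>"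
      using am by (intro infdist_sinh_curve) (auto simp: good_def)
    assume "inside_if_acute am ap \<alpha> \<sigma> b \<omega>"
    with good show "sinh_curve \<sigma> b \<omega> \<subseteq> U_dom am ap \<alpha>" by (rule inside)
    with good show "coefficient_formula u f n \<sigma> b \<omega>" by (rule formula)
  next
    fix \<omega> b \<sigma>
    assume obtuse: "pi/2 < \<alpha>" and *: "\<omega> \<in> {pi/2 - \<alpha> <.. 0}" "0 < b"
      "\<sigma> \<in> {am + b * sin \<omega> <..< ap + b * sin \<omega>}"
    from * have good: "good \<sigma> b \<omega>" by (rule good_if_nonpos)
    then show "sinh_curve \<sigma> b \<omega> \<subseteq> U_dom am ap \<alpha>"
      by (rule inside) (use obtuse in \<open>simp add: inside_if_acute_def\<close>)
    with good show "coefficient_formula u f n \<sigma> b \<omega>" by (rule formula)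
  next
    fix \<sigma> b \<omega>
    assume "admissible am ap \<alpha> \<sigma> b \<omega> \<or> (pi/2 < \<alpha> \<and> \<omega> \<in> {pi/2 - \<alpha> <.. 0} \<and> b > 0 \<and>
      \<sigma> \<in> {am + b * sin \<omega> <..< ap + b * sin \<omega>})"
    then have "good \<sigma> b \<omega>" using good_if_admissible good_if_nonpos by blast
    then show "\<exists>d>0. (inside_if_acute am ap \<alpha> \<sigma> b \<omega> \<longrightarrow> chi \<sigma> b \<omega> ` strip d \<subseteq> U_dom am ap \<alpha>) \<and>
        infdist 0 (chi \<sigma> b \<omega> ` strip d) = \<sigma> - b * sin (\<omega> + d)"
      by (rule strip_distance)
  qed
qed

end
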